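(* Let $G$ be a locally compact Polish group with a right-invariant compatible metric $d$. Suppose there is a sequence of compact subgroups $K_1\le K_2\le\cdots\le G$ whose union is dense in $G$, and suppose that each $K_n$ admits a finite chain of compact subgroups $$\{e\}=H_{n,0}\le H_{n,1}\le\cdots\le H_{n,M_n}=K_n$$ such that the quotient radii $\rho_{n,i}:=\sup_{g\in H_{n,i}}\inf_{h\in H_{n,i-1}}d(e,gh)$, $1\le i\le M_n$, satisfy $$\sup_{n\ge1}\sum_{i=1}^{M_n}\rho_{n,i}<+\infty\qquad\text{and}\qquad \max_{1\le i\le M_n}\rho_{n,i}\to0\ \text{ as } n\to\infty.$$ Then $G$ is the trivial group.
   Context: Right-invariance of $d$ means $d(xg,yg)=d(x,y)$ for all $x,y,g\in G$; compatible means that $d$ induces the topology of $G$. $e$ denotes the identity of $G$. *)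

theory Defs
  imports "HOL-Analysis.Analysis" "HOL-Algebra.Elementary_Groups"
begin

definition topological_group :: "('a, 'b) monoid_scheme \<Rightarrow> 'a topology \<Rightarrow> bool" where
  "topological_group G T \<longleftrightarrow>
     group G \<and> topspace T = carrier G \<and>
     continuous_map (prod_topology T T) T (\<lambda>(x, y). x \<otimes>\<^bsub>G\<^esub> y) \<and>
     continuous_map T T (\<lambda>x. inv\<^bsub>G\<^esub> x)"

definition Polish_space :: "'a topology \<Rightarrow> bool" where
  "Polish_space T \<longleftrightarrow> separable_space T \<and> completely_metrizable_space T"

definition compatible_metric :: "'a topology \<Rightarrow> ('a \<Rightarrow> 'a \<Rightarrow> real) \<Rightarrow> bool" where
  "compatible_metric T d \<longleftrightarrow>
     Metric_space (topspace T) d \<and> Metric_space.mtopology (topspace T) d = T"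

definition right_invariant :: "('a, 'b) monoid_scheme \<Rightarrow> ('a \<Rightarrow> 'a \<Rightarrow> real) \<Rightarrow> bool" where
  "right_invariant G d \<longleftrightarrow>
     (\<forall>x\<in>carrier G. \<forall>y\<in>carrier G. \<forall>g\<in>carrier G.
        d (x \<otimes>\<^bsub>G\<^esub> g) (y \<otimes>\<^bsub>G\<^esub> g) = d x y)"

definition compact_subgroup :: "('a, 'b) monoid_scheme \<Rightarrow> 'a topology \<Rightarrow> 'a set \<Rightarrow> bool" where
  "compact_subgroup G T H \<longleftrightarrow> subgroup H G \<and> compactin T H"

text \<open>For a compatible metric, a compact subgroup \<open>H\<close> and a subgroup \<open>H' \<subseteq> H\<close>, the
  values below are bounded (by 0 and by the maximal distance from the identity to a point of
  \<open>H\<close>), so the real-valued supremum and infimum are the true ones.\<close>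

definition quotient_radius ::
    "('a, 'b) monoid_scheme \<Rightarrow> ('a \<Rightarrow> 'a \<Rightarrow> real) \<Rightarrow> 'a set \<Rightarrow> 'a set \<Rightarrow> real" where
  "quotient_radius G d H H' = (SUP g\<in>H. INF h\<in>H'. d \<one>\<^bsub>G\<^esub> (g \<otimes>\<^bsub>G\<^esub> h))"

end

theory Submission
  imports Defs
begin

text \<open>
  A compact neighbourhood of the identity and the bound on the sums of radii show that all \<open>K n\<close>
  lie in one compact set, so \<open>G\<close> is compact and
  \<open>sup\<^sub>g d (g x) (g y)\<close> is a bi-invariant metric, uniformly equivalent to \<open>d\<close>.

  On a totally bounded group with a bi-invariant metric \<open>D\<close>, averages over finitely many right
  translates of a Lipschitz function become nearly constant, which gives an invariant mean.
  If \<open>G\<close> is nontrivial, power iteration of the compact self-adjoint operator with kernel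
  \<open>max 0 (r - D x y)\<close>, started at a function of mean zero, yields a nonconstant eigenfunction of its
  square. On the translation-invariant eigenspace, translations by elements near the identity are
  uniformly close to the identity, so a subgroup that moves every eigenfunction only slightly fixes
  all of them. If the steps of a chain of subgroups are small enough, it follows inductively that
  each subgroup in the chain acts trivially on the eigenspace. Hence \<open>K n\<close> does so for large \<open>n\<close>, and
  by density every eigenfunction is constant, a contradiction.
\<close>

section \<open>Finite averages\<close>

text \<open>Each invariance of \<open>D\<close> has its own use. Left invariance makes the kernel
  operator commute with left translations, so its eigenspaces are stable under them. Right
  invariance gives \<open>D (b \<otimes> x) x = D \<one> b\<close>, so the effect of a translation
  is controlled by its element alone. The eigenspace stands in for a finite-dimensional
  representation, but its dimension never enters: applying the operator twice turns a sup bound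
  \<open>B\<close> into the Lipschitz constant \<open>r * B\<close>, so the eigenvalue equation
  itself gives one modulus of continuity for all eigenfunctions. The square is taken because the
  operator may have negative eigenvalues, while the norm ratios of a power iteration see only the
  eigenvalue of the square. The obstacle in the induction is that errors could add up along a chain
  of unbounded length. The dichotomy "moves little, hence moves nothing" resets the error to zero at
  each subgroup, so only the size of a single step counts there. The bound on the sums of radii
  serves compactness.\<close>

lemma sum_list_le_length_mult:
  fixes b :: real
  assumes "\<And>x. x \<in> set xs \<Longrightarrow> F x \<le> b"
  shows "sum_list (map F xs) \<le> b * length xs"
  using assms by (induction xs) (force simp: algebra_simps)+

lemma sum_list_le_length_mult_minus:
  fixes b :: real
  assumes "\<And>x. x \<in> set xs \<Longrightarrow> F x \<le> b" and "y \<in> set xs" and "F y \<le> b - t"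
  shows "sum_list (map F xs) \<le> b * length xs - t"
  using assms
proof (induction xs)
  case (Cons a xs)
  show ?case
  proof (cases "a = y")
    case True
    have "sum_list (map F xs) \<le> b * length xs"
      using Cons.prems by (intro sum_list_le_length_mult) auto
    then show ?thesis
      using True Cons.prems by (auto simp: algebra_simps)
  next
    case False
    then have "sum_list (map F xs) \<le> b * length xs - t"
      using Cons by auto
    moreover have "F a \<le> b"
      using Cons.prems by auto
    ultimately show ?thesis
      by (simp add: algebra_simps)
  qed
qed simp

lemma sum_list_product:
  fixes F :: "'a \<Rightarrow> 'b \<Rightarrow> real"
  shows "sum_list (map (\<lambda>(x, y). F x y) (List.product xs ys)) = (\<Sum>x\<leftarrow>xs. \<Sum>y\<leftarrow>ys. F x y)"
  by (induction xs) (auto simp: o_def)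

lemma sum_list_swap:
  fixes F :: "'a \<Rightarrow> 'b \<Rightarrow> real"
  shows "(\<Sum>x\<leftarrow>xs. \<Sum>y\<leftarrow>ys. F x y) = (\<Sum>y\<leftarrow>ys. \<Sum>x\<leftarrow>xs. F x y)"
  by (induction xs) (auto simp: sum_list_addf)

text \<open>Lists keep multiplicities, so an average of averages is again an average, over the list
  of all products.\<close>

definition avg :: "'a list \<Rightarrow> ('a \<Rightarrow> real) \<Rightarrow> real" where
  "avg xs F = sum_list (map F xs) / length xs"

lemma avg_cong: "(\<And>x. x \<in> set xs \<Longrightarrow> F x = F' x) \<Longrightarrow> avg xs F = avg xs F'"
  unfolding avg_def by (metis map_cong)

lemma avg_le:
  assumes "xs \<noteq> []" and "\<And>x. x \<in> set xs \<Longrightarrow> F x \<le> b"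
  shows "avg xs F \<le> b"
  using sum_list_le_length_mult[of xs F b] assms unfolding avg_def by (simp add: divide_le_eq)

lemma avg_uminus: "avg xs (\<lambda>x. - F x) = - avg xs F"
  unfolding avg_def uminus_sum_list_map minus_divide_left by (simp add: o_def)

lemma avg_add: "avg xs (\<lambda>x. F x + F' x) = avg xs F + avg xs F'"
  unfolding avg_def by (simp add: sum_list_addf add_divide_distrib)

lemma avg_diff: "avg xs (\<lambda>x. F x - F' x) = avg xs F - avg xs F'"
  using avg_add[of xs F "\<lambda>x. - F' x"] by (simp add: avg_uminus)

lemma avg_mult: "avg xs (\<lambda>x. c * F x) = c * avg xs F"
  unfolding avg_def by (simp add: sum_list_const_mult)

lemma avg_const: "xs \<noteq> [] \<Longrightarrow> avg xs (\<lambda>x. c) = c"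
  unfolding avg_def by (simp add: sum_list_triv)

lemma avg_abs_le:
  assumes "xs \<noteq> []" and "\<And>x. x \<in> set xs \<Longrightarrow> \<bar>F x - F' x\<bar> \<le> b"
  shows "\<bar>avg xs F - avg xs F'\<bar> \<le> b"
proof -
  have "avg xs (\<lambda>x. F x - F' x) \<le> b"
    using assms by (intro avg_le) force+
  moreover have "avg xs (\<lambda>x. - (F x - F' x)) \<le> b"
    using assms by (intro avg_le) force+
  ultimately show ?thesis
    unfolding avg_uminus avg_diff by linarith
qed

lemma avg_abs_le_const:
  assumes "xs \<noteq> []" and "\<And>x. x \<in> set xs \<Longrightarrow> \<bar>F x - c\<bar> \<le> b"
  shows "\<bar>avg xs F - c\<bar> \<le> b"
  using avg_abs_le[of xs F "\<lambda>_. c" b] assms by (simp add: avg_const)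

lemma avg_le_minus:
  assumes "\<And>x. x \<in> set xs \<Longrightarrow> F x \<le> b" and "y \<in> set xs" and "F y \<le> b - t"
  shows "avg xs F \<le> b - t / length xs"
proof -
  have "length xs > 0" using assms(2) by (auto intro: length_pos_if_in_set)
  then show ?thesis
    using sum_list_le_length_mult_minus[of xs F b y t] assms unfolding avg_def by (simp add: field_simps)
qed

lemma avg_swap: "avg xs (\<lambda>x. avg ys (F x)) = avg ys (\<lambda>y. avg xs (\<lambda>x. F x y))"
  unfolding avg_def divide_inverse sum_list_mult_const by (subst sum_list_swap) simp

lemma avg_product: "avg (List.product xs ys) (\<lambda>(x, y). F x y) = avg xs (\<lambda>x. avg ys (F x))"
  unfolding avg_def by (simp add: sum_list_product divide_inverse sum_list_mult_const)

lemma avg_map: "avg (map h xs) F = avg xs (\<lambda>x. F (h x))"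
  unfolding avg_def by (simp add: o_def)

section \<open>The invariant mean on Lipschitz functions\<close>

locale bi_invariant_group = group G for G (structure) +
  fixes D :: "'a \<Rightarrow> 'a \<Rightarrow> real"
  assumes D_refl: "x \<in> carrier G \<Longrightarrow> D x x = 0"
    and D_pos: "x \<in> carrier G \<Longrightarrow> y \<in> carrier G \<Longrightarrow> x \<noteq> y \<Longrightarrow> D x y > 0"
    and D_sym: "x \<in> carrier G \<Longrightarrow> y \<in> carrier G \<Longrightarrow> D x y = D y x"
    and D_triangle: "x \<in> carrier G \<Longrightarrow> y \<in> carrier G \<Longrightarrow> z \<in> carrier G \<Longrightarrow> D x z \<le> D x y + D y z"
    and D_left: "g \<in> carrier G \<Longrightarrow> x \<in> carrier G \<Longrightarrow> y \<in> carrier G \<Longrightarrow> D (g \<otimes> x) (g \<otimes> y) = D x y"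
    and D_right: "g \<in> carrier G \<Longrightarrow> x \<in> carrier G \<Longrightarrow> y \<in> carrier G \<Longrightarrow> D (x \<otimes> g) (y \<otimes> g) = D x y"
    and D_net: "\<epsilon> > 0 \<Longrightarrow> \<exists>N. finite N \<and> N \<subseteq> carrier G \<and> (\<forall>x\<in>carrier G. \<exists>y\<in>N. D y x < \<epsilon>)"
begin

lemma D_nonneg: "x \<in> carrier G \<Longrightarrow> y \<in> carrier G \<Longrightarrow> 0 \<le> D x y"
  using D_pos[of x y] D_refl[of x] by (cases "x = y") auto

text \<open>Multiplying by \<open>x\<close> on the left and by \<open>y\<close> on the right turns
  the two inverses into \<open>y\<close> and \<open>x\<close>; both invariances are needed.\<close>

lemma D_inv: "x \<in> carrier G \<Longrightarrow> y \<in> carrier G \<Longrightarrow> D (inv x) (inv y) = D x y"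
  using D_left[of x "inv x" "inv y"] D_right[of y \<one> "x \<otimes> inv y"] D_sym[of x y]
  by (simp add: m_assoc)

lemma D_cancel_left:
  "x \<in> carrier G \<Longrightarrow> y \<in> carrier G \<Longrightarrow> g \<in> carrier G \<Longrightarrow> D (x \<otimes> g) y = D g (inv x \<otimes> y)"
  using D_left[of "inv x" "x \<otimes> g" y] by (simp add: m_assoc[symmetric])

lemma D_cancel_right:
  "x \<in> carrier G \<Longrightarrow> y \<in> carrier G \<Longrightarrow> g \<in> carrier G \<Longrightarrow> D (g \<otimes> x) y = D g (y \<otimes> inv x)"
  using D_right[of "inv x" "g \<otimes> x" y] by (simp add: m_assoc)

lemma D_net_list:
  assumes "\<epsilon> > 0"
  obtains xs where "xs \<noteq> []" "set xs \<subseteq> carrier G" "\<And>x. x \<in> carrier G \<Longrightarrow> \<exists>y\<in>set xs. D y x < \<epsilon>"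
proof -
  obtain N where N: "finite N" "N \<subseteq> carrier G" "\<forall>x\<in>carrier G. \<exists>y\<in>N. D y x < \<epsilon>"
    using D_net[OF assms] by blast
  obtain xs where "set xs = N"
    using finite_list[OF N(1)] by blast
  with N show thesis
    using one_closed by (intro that[of xs]) auto
qed

section \<open>Lipschitz functions\<close>

definition lipc :: "real \<Rightarrow> ('a \<Rightarrow> real) \<Rightarrow> bool" where
  "lipc L f \<longleftrightarrow> (\<forall>x\<in>carrier G. \<forall>y\<in>carrier G. \<bar>f x - f y\<bar> \<le> L * D x y)"

definition lip :: "('a \<Rightarrow> real) \<Rightarrow> bool" where
  "lip f \<longleftrightarrow> (\<exists>L. lipc L f)"

lemma lipcD: "lipc L f \<Longrightarrow> x \<in> carrier G \<Longrightarrow> y \<in> carrier G \<Longrightarrow> \<bar>f x - f y\<bar> \<le> L * D x y"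
  unfolding lipc_def by blast

lemma lipc_lip: "lipc L f \<Longrightarrow> lip f"
  unfolding lip_def by blast

lemma lipc_mono: "lipc L f \<Longrightarrow> L \<le> L' \<Longrightarrow> lipc L' f"
  unfolding lipc_def by (meson D_nonneg mult_right_mono order_trans)

lemma lipE:
  assumes "lip f"
  obtains L where "L > 0" "lipc L f"
proof -
  obtain L where "lipc L f" using assms unfolding lip_def by blast
  then have "lipc (max L 1) f" by (rule lipc_mono) simp
  then show thesis by (intro that[of "max L 1"]) auto
qed

lemma D_bounded: obtains C where "C > 0" "\<And>x y. x \<in> carrier G \<Longrightarrow> y \<in> carrier G \<Longrightarrow> D x y \<le> C"
proof -
  obtain xs where xs: "xs \<noteq> []" "set xs \<subseteq> carrier G" "\<And>x. x \<in> carrier G \<Longrightarrow> \<exists>y\<in>set xs. D y x < 1"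
    using D_net_list[of 1] by auto
  define S where "S = (\<Sum>y\<in>set xs. D y \<one>)"
  have *: "D x \<one> \<le> 1 + S" if x: "x \<in> carrier G" for x
  proof -
    obtain y where y: "y \<in> set xs" "D y x < 1" using xs(3)[OF x] by blast
    have "D y \<one> \<le> S"
      unfolding S_def using y xs(2) D_nonneg by (intro member_le_sum) auto
    then show ?thesis
      using D_triangle[of x y \<one>] D_sym[of x y] x y xs(2) by auto
  qed
  have S0: "S \<ge> 0"
    unfolding S_def using xs(2) D_nonneg by (intro sum_nonneg) auto
  have "D x y \<le> 2 + 2 * S" if "x \<in> carrier G" "y \<in> carrier G" for x y
    using D_triangle[of x \<one> y] D_sym[of \<one> y] *[of x] *[of y] that by auto
  then show thesis
    using S0 by (intro that[of "2 + 2 * S"]) auto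
qed

lemma lip_bounded:
  assumes "lip f" obtains B where "B > 0" "\<And>x. x \<in> carrier G \<Longrightarrow> \<bar>f x\<bar> \<le> B"
proof -
  obtain L where L: "L > 0" "lipc L f" by (rule lipE[OF assms])
  obtain C where C: "C > 0" "\<And>x y. x \<in> carrier G \<Longrightarrow> y \<in> carrier G \<Longrightarrow> D x y \<le> C"
    using D_bounded by blast
  have "\<bar>f x\<bar> \<le> \<bar>f \<one>\<bar> + L * C" if x: "x \<in> carrier G" for x
  proof -
    have "\<bar>f x - f \<one>\<bar> \<le> L * D x \<one>" using lipcD[OF L(2)] x by auto
    also have "\<dots> \<le> L * C" using C(2)[of x \<one>] L(1) x by auto
    finally show ?thesis by linarith
  qed
  moreover have "L * C > 0" using L C by simp
  ultimately show thesis by (intro that[of "\<bar>f \<one>\<bar> + L * C"]) auto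
qed

lemma lipc_const: "lipc 0 (\<lambda>_. c)"
  unfolding lipc_def by simp

lemma lip_const [intro, simp]: "lip (\<lambda>_. c)"
  using lipc_const lipc_lip by blast

lemma lip_add [intro]:
  assumes "lip f" "lip g" shows "lip (\<lambda>x. f x + g x)"
proof -
  obtain L L' where "lipc L f" "lipc L' g" using assms unfolding lip_def by blast
  then have "lipc (L + L') (\<lambda>x. f x + g x)"
    unfolding lipc_def by (fastforce simp: algebra_simps abs_le_iff)
  then show ?thesis by (rule lipc_lip)
qed

lemma lip_mult [intro]:
  assumes "lip f" "lip g" shows "lip (\<lambda>x. f x * g x)"
proof -
  obtain L where L: "L > 0" "lipc L f" by (rule lipE[OF assms(1)])
  obtain L' where L': "L' > 0" "lipc L' g" by (rule lipE[OF assms(2)])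
  obtain B where B: "B > 0" "\<And>x. x \<in> carrier G \<Longrightarrow> \<bar>f x\<bar> \<le> B" using lip_bounded[OF assms(1)] by blast
  obtain B' where B': "B' > 0" "\<And>x. x \<in> carrier G \<Longrightarrow> \<bar>g x\<bar> \<le> B'" using lip_bounded[OF assms(2)] by blast
  have "\<bar>f x * g x - f y * g y\<bar> \<le> (B * L' + B' * L) * D x y"
    if x: "x \<in> carrier G" and y: "y \<in> carrier G" for x y
  proof -
    have "f x * g x - f y * g y = f x * (g x - g y) + g y * (f x - f y)"
      by (simp add: algebra_simps)
    also have "\<bar>\<dots>\<bar> \<le> \<bar>f x\<bar> * \<bar>g x - g y\<bar> + \<bar>g y\<bar> * \<bar>f x - f y\<bar>"
      by (metis abs_mult abs_triangle_ineq)
    also have "\<dots> \<le> B * (L' * D x y) + B' * (L * D x y)"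
      using B B' L L' x y by (intro add_mono mult_mono lipcD) auto
    finally show ?thesis by (simp add: algebra_simps)
  qed
  then show ?thesis by (intro lipc_lip) (auto simp: lipc_def)
qed

lemma lip_cmult [intro]: "lip f \<Longrightarrow> lip (\<lambda>x. c * f x)"
  by (rule lip_mult) auto

lemma lip_diff [intro]: "lip f \<Longrightarrow> lip g \<Longrightarrow> lip (\<lambda>x. f x - g x)"
  using lip_add[of f "\<lambda>x. (-1) * g x"] lip_cmult[of g "-1"] by simp

lemma lipc_left: "lipc L f \<Longrightarrow> a \<in> carrier G \<Longrightarrow> lipc L (\<lambda>x. f (a \<otimes> x))"
  unfolding lipc_def by (metis D_left m_closed)

lemma lipc_right: "lipc L f \<Longrightarrow> a \<in> carrier G \<Longrightarrow> lipc L (\<lambda>x. f (x \<otimes> a))"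
  unfolding lipc_def by (metis D_right m_closed)

lemma lip_left: "lip f \<Longrightarrow> a \<in> carrier G \<Longrightarrow> lip (\<lambda>x. f (a \<otimes> x))"
  unfolding lip_def using lipc_left by blast

lemma lip_sum_list:
  "(\<And>g. g \<in> set gs \<Longrightarrow> lip (F g)) \<Longrightarrow> lip (\<lambda>x. \<Sum>g\<leftarrow>gs. F g x)"
  by (induction gs) auto

section \<open>Averages over right translates\<close>

definition nlist :: "'a list \<Rightarrow> bool" where
  "nlist gs \<longleftrightarrow> gs \<noteq> [] \<and> set gs \<subseteq> carrier G"

definition ravg :: "'a list \<Rightarrow> ('a \<Rightarrow> real) \<Rightarrow> 'a \<Rightarrow> real" where
  "ravg gs f x = avg gs (\<lambda>g. f (x \<otimes> g))"

definition osc_le :: "('a \<Rightarrow> real) \<Rightarrow> real \<Rightarrow> bool" where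
  "osc_le f c \<longleftrightarrow> (\<forall>x\<in>carrier G. \<forall>y\<in>carrier G. f x - f y \<le> c)"

lemma lipc_ravg:
  assumes "lipc L f" "nlist gs" shows "lipc L (ravg gs f)"
  unfolding lipc_def ravg_def
proof (intro ballI avg_abs_le)
  fix x y g assume "x \<in> carrier G" "y \<in> carrier G" "g \<in> set gs"
  then show "\<bar>f (x \<otimes> g) - f (y \<otimes> g)\<bar> \<le> L * D x y"
    using lipcD[OF lipc_right[OF assms(1)], of g x y] assms(2) unfolding nlist_def by auto
qed (use assms in \<open>auto simp: nlist_def\<close>)

lemma osc_le_ravg:
  assumes "osc_le f c" "nlist gs" shows "osc_le (ravg gs f) c"
  unfolding osc_le_def ravg_def avg_diff[symmetric]
proof (intro ballI avg_le)
  fix x y g assume "x \<in> carrier G" "y \<in> carrier G" "g \<in> set gs"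
  then show "f (x \<otimes> g) - f (y \<otimes> g) \<le> c"
    using assms unfolding nlist_def osc_le_def by auto
qed (use assms in \<open>auto simp: nlist_def\<close>)

text \<open>The list of all products \<open>g \<otimes> h\<close> works. It depends neither on
  \<open>f\<close> nor on \<open>x\<close>, which is what allows averaging to be iterated and one
  list to serve several functions.\<close>

lemma ravg_ravg:
  assumes "nlist gs" "nlist hs"
  obtains ks where "nlist ks" "\<And>f x. x \<in> carrier G \<Longrightarrow> ravg gs (ravg hs f) x = ravg ks f x"
proof
  define ks where "ks = map (\<lambda>(g, h). g \<otimes> h) (List.product gs hs)"
  have "set ks = (\<lambda>(g, h). g \<otimes> h) ` (set gs \<times> set hs)"
    unfolding ks_def by simp
  moreover have "set gs \<times> set hs \<noteq> {}"
    using assms unfolding nlist_def by (simp add: Times_empty)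
  ultimately have "ks \<noteq> []" by (metis image_is_empty set_empty)
  then show "nlist ks"
    using assms \<open>set ks = _\<close> unfolding nlist_def by (auto simp: subset_iff)
  fix f x assume x: "x \<in> carrier G"
  have "ravg ks f x = avg (List.product gs hs) (\<lambda>(g, h). f (x \<otimes> (g \<otimes> h)))"
    unfolding ks_def ravg_def avg_map by (simp add: split_def)
  also have "\<dots> = avg gs (\<lambda>g. avg hs (\<lambda>h. f (x \<otimes> g \<otimes> h)))"
    unfolding avg_product using assms x by (intro avg_cong) (auto simp: m_assoc nlist_def subset_iff)
  finally show "ravg gs (ravg hs f) x = ravg ks f x"
    unfolding ravg_def by simp
qed

text \<open>Averaging over the translates by a fine net lowers the maximum by a fixed amount as long as
  the oscillation exceeds \<open>c\<close>, so iterating it must bring the oscillation below \<open>c\<close>.\<close>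
lemma ravg_small_osc:
  assumes "lip f" "c > 0"
  obtains gs where "nlist gs" "osc_le (ravg gs f) c"
proof -
  obtain L where L: "L > 0" "lipc L f" by (rule lipE[OF assms(1)])
  obtain B where B: "B > 0" "\<And>x. x \<in> carrier G \<Longrightarrow> \<bar>f x\<bar> \<le> B" using lip_bounded[OF assms(1)] by blast
  \<comment> \<open>At this fineness a Lipschitz function with constant \<open>L\<close> changes by
    less than \<open>c / 2\<close> between a point and its net point.\<close>
  obtain xs where xs: "xs \<noteq> []" "set xs \<subseteq> carrier G"
    "\<And>x. x \<in> carrier G \<Longrightarrow> \<exists>y\<in>set xs. D y x < c / (2 * L)"
    using D_net_list[of "c / (2 * L)"] L assms(2) by auto
  have nxs: "nlist xs" using xs unfolding nlist_def by auto
  \<comment> \<open>The drop of an average in which one entry lies \<open>c / 2\<close> below the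
    common bound.\<close>
  define t where "t = c / 2 / length xs"
  have t: "t > 0" using xs assms(2) unfolding t_def by auto
  have step: "\<exists>gs. nlist gs \<and> (osc_le (ravg gs f) c \<or>
      (\<forall>x\<in>carrier G. - B \<le> ravg gs f x \<and> ravg gs f x \<le> B - k * t))" for k :: nat
  proof (induction k)
    case 0
    have "ravg [\<one>] f x = f x" if "x \<in> carrier G" for x
      unfolding ravg_def avg_def using that by simp
    moreover have "nlist [\<one>]" unfolding nlist_def by simp
    ultimately show ?case using B(2) by (intro exI[of _ "[\<one>]"]) (auto simp: abs_le_iff minus_le_iff)
  next
    case (Suc k)
    then obtain gs where gs: "nlist gs" and alt: "osc_le (ravg gs f) c \<or>
      (\<forall>x\<in>carrier G. - B \<le> ravg gs f x \<and> ravg gs f x \<le> B - k * t)" by blast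
    show ?case
    proof (cases "osc_le (ravg gs f) c")
      case True
      with gs show ?thesis by blast
    next
      case False
      then have bd: "- B \<le> ravg gs f x" "ravg gs f x \<le> B - k * t" if "x \<in> carrier G" for x
        using alt that by auto
      obtain p q where pq: "p \<in> carrier G" "q \<in> carrier G" "ravg gs f p - ravg gs f q > c"
        using False unfolding osc_le_def by force
      define F where "F = ravg gs f"
      obtain ks where ks: "nlist ks" "\<And>f x. x \<in> carrier G \<Longrightarrow> ravg xs (ravg gs f) x = ravg ks f x"
        using ravg_ravg[OF nxs gs] by blast
      have lF: "lipc L F" unfolding F_def using lipc_ravg[OF L(2) gs] .
      have "- B \<le> ravg xs F x \<and> ravg xs F x \<le> B - Suc k * t" if x: "x \<in> carrier G" for x
      proof
        have "avg xs (\<lambda>g. - F (x \<otimes> g)) \<le> B"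
          using bd xs x unfolding F_def by (intro avg_le) (auto simp: subset_iff minus_le_iff)
        then show "- B \<le> ravg xs F x" unfolding ravg_def avg_uminus by simp
        \<comment> \<open>\<open>q\<close> lies more than \<open>c\<close> below the current upper
          bound, and this choice of \<open>g\<close> brings \<open>x \<otimes> g\<close> close to
          \<open>q\<close>; that translate is the entry which lowers the average.\<close>
        obtain g where g: "g \<in> set xs" "D g (inv x \<otimes> q) < c / (2 * L)"
          using xs(3)[of "inv x \<otimes> q"] x pq by auto
        have gc: "g \<in> carrier G" using g xs by auto
        have "F (x \<otimes> g) - F q \<le> L * D (x \<otimes> g) q"
          using lipcD[OF lF, of "x \<otimes> g" q] x gc pq by auto
        also have "\<dots> \<le> c / 2"
          using g(2) L x gc pq by (auto simp: D_cancel_left field_simps)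
        finally have "F (x \<otimes> g) \<le> (B - k * t) - c / 2"
          using pq(3) bd(2)[OF pq(1)] unfolding F_def by linarith
        then have "avg xs (\<lambda>g. F (x \<otimes> g)) \<le> (B - k * t) - c / 2 / length xs"
          using bd xs x g unfolding F_def by (intro avg_le_minus[of _ _ _ g]) (auto simp: subset_iff)
        then show "ravg xs F x \<le> B - Suc k * t"
          unfolding ravg_def t_def[symmetric] by (simp add: distrib_right)
      qed
      then show ?thesis using ks unfolding F_def by (intro exI[of _ ks]) auto
    qed
  qed
  \<comment> \<open>After so many steps the upper bound \<open>B - k * t\<close> would fall below
    the lower bound \<open>- B\<close>.\<close>
  obtain k :: nat where k: "k * t > 2 * B"
    using reals_Archimedean3[OF t] by blast
  obtain gs where gs: "nlist gs" and alt: "osc_le (ravg gs f) c \<or>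
      (\<forall>x\<in>carrier G. - B \<le> ravg gs f x \<and> ravg gs f x \<le> B - k * t)" using step[of k] by blast
  have "osc_le (ravg gs f) c"
    using alt
  proof
    assume "\<forall>x\<in>carrier G. - B \<le> ravg gs f x \<and> ravg gs f x \<le> B - k * t"
    from bspec[OF this one_closed] k have False by linarith
    then show ?thesis ..
  qed
  with gs show thesis by (rule that)
qed

text \<open>The functions are treated one after the other: further averaging never increases an
  oscillation already made small.\<close>

lemma ravg_small_osc_family:
  assumes "finite S" "\<And>f. f \<in> S \<Longrightarrow> lip f" "c > 0"
  shows "\<exists>gs. nlist gs \<and> (\<forall>f\<in>S. osc_le (ravg gs f) c)"
  using assms(1,2)
proof (induction S)
  case empty
  have "nlist [\<one>]" unfolding nlist_def by simp
  then show ?case by blast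
next
  case (insert f S)
  then obtain gs where gs: "nlist gs" "\<forall>f\<in>S. osc_le (ravg gs f) c" by auto
  have "lip (ravg gs f)"
    using insert.prems lipc_ravg[OF _ gs(1)] unfolding lip_def by blast
  then obtain hs where hs: "nlist hs" "osc_le (ravg hs (ravg gs f)) c"
    using ravg_small_osc assms(3) by blast
  obtain ks where ks: "nlist ks" "\<And>f x. x \<in> carrier G \<Longrightarrow> ravg hs (ravg gs f) x = ravg ks f x"
    using ravg_ravg[OF hs(1) gs(1)] by blast
  have "osc_le (ravg ks f') c" if "f' \<in> insert f S" for f'
  proof -
    have "osc_le (ravg hs (ravg gs f')) c"
      using that hs gs osc_le_ravg by blast
    then show ?thesis unfolding osc_le_def using ks(2) by simp
  qed
  with ks(1) show ?case by blast
qed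

text \<open>Inversion exchanges left and right translates, and \<open>f\<close> composed with it is
  still Lipschitz by \<open>D_inv\<close>.\<close>

lemma left_avg_small_osc:
  assumes "lip f" "c > 0"
  obtains hs where "nlist hs" "osc_le (\<lambda>x. avg hs (\<lambda>h. f (h \<otimes> x))) c"
proof -
  have "lip (\<lambda>x. f (inv x))"
    using assms(1) unfolding lip_def lipc_def by (metis D_inv inv_closed)
  then obtain gs where gs: "nlist gs" "osc_le (ravg gs (\<lambda>x. f (inv x))) c"
    using ravg_small_osc assms(2) by blast
  define hs where "hs = map (m_inv G) gs"
  have "avg hs (\<lambda>h. f (h \<otimes> x)) = ravg gs (\<lambda>x. f (inv x)) (inv x)" if "x \<in> carrier G" for x
    unfolding hs_def avg_map ravg_def using that gs(1)
    by (intro avg_cong) (auto simp: inv_mult_group nlist_def subset_iff)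
  then have "osc_le (\<lambda>x. avg hs (\<lambda>h. f (h \<otimes> x))) c"
    using gs(2) unfolding osc_le_def by simp
  moreover have "nlist hs" using gs(1) unfolding hs_def nlist_def by auto
  ultimately show thesis using that by blast
qed

text \<open>Right averages nearly equal to a constant have comparable values, since each of them can be
  compared with a single left average.\<close>
lemma mean_exists:
  assumes "lip f"
  shows "\<exists>m. \<forall>gs c. nlist gs \<longrightarrow> osc_le (ravg gs f) c \<longrightarrow> (\<forall>x\<in>carrier G. \<bar>ravg gs f x - m\<bar> \<le> c)"
proof -
  define P where "P gs c \<longleftrightarrow> nlist gs \<and> osc_le (ravg gs f) c" for gs c
  have comp: "ravg gs f x - c \<le> ravg gs' f y + c'"
    if P: "P gs c" "P gs' c'" and x: "x \<in> carrier G" and y: "y \<in> carrier G" for gs c gs' c' x y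
  proof (rule field_le_epsilon)
    fix e :: real assume "e > 0"
    then obtain hs where hs: "nlist hs" "osc_le (\<lambda>x. avg hs (\<lambda>h. f (h \<otimes> x))) (e / 2)"
      using left_avg_small_osc[OF assms, of "e / 2"] by auto
    define m where "m = avg hs (\<lambda>h. f (h \<otimes> \<one>))"
    have key: "\<bar>ravg gs f x - m\<bar> \<le> c + e / 2" if P: "P gs c" and x: "x \<in> carrier G" for gs c x
    proof -
      \<comment> \<open>The double average over \<open>hs\<close> and \<open>gs\<close> is within
        \<open>c\<close> of \<open>ravg gs f x\<close> in one order of summation and within
        \<open>e / 2\<close> of \<open>m\<close> in the other.\<close>
      have sw: "avg hs (\<lambda>h. ravg gs f h) = avg gs (\<lambda>g. avg hs (\<lambda>h. f (h \<otimes> g)))"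
        unfolding ravg_def by (rule avg_swap)
      have "\<bar>avg hs (\<lambda>h. ravg gs f h) - ravg gs f x\<bar> \<le> c"
        using hs(1) P x unfolding P_def nlist_def osc_le_def
        by (intro avg_abs_le_const) (auto simp: abs_le_iff subset_iff)
      moreover have "\<bar>avg hs (\<lambda>h. f (h \<otimes> g)) - m\<bar> \<le> e / 2" if "g \<in> carrier G" for g
        using hs(2)[unfolded osc_le_def, rule_format, OF that one_closed]
          hs(2)[unfolded osc_le_def, rule_format, OF one_closed that] unfolding m_def by linarith
      then have "\<bar>avg gs (\<lambda>g. avg hs (\<lambda>h. f (h \<otimes> g))) - m\<bar> \<le> e / 2"
        using P unfolding P_def nlist_def by (intro avg_abs_le_const[where F = "\<lambda>g. avg hs (\<lambda>h. f (h \<otimes> g))"]) auto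
      ultimately show ?thesis using sw by linarith
    qed
    show "ravg gs f x - c \<le> ravg gs' f y + c' + e"
      using key[OF P(1) x] key[OF P(2) y] by linarith
  qed
  \<comment> \<open>By \<open>comp\<close>, every lower estimate lies below every upper estimate, so
    the supremum of the lower ones lies in all the intervals at once.\<close>
  define Lo where "Lo = {ravg gs f x - c |gs c x. P gs c \<and> x \<in> carrier G}"
  obtain gs0 where "P gs0 1"
    using ravg_small_osc[OF assms, of 1] unfolding P_def by auto
  then have Lo0: "Lo \<noteq> {}" unfolding Lo_def by blast
  have up: "l \<le> ravg gs f x + c" if "l \<in> Lo" "P gs c" "x \<in> carrier G" for l gs c x
    using that comp unfolding Lo_def by blast
  then have bdd: "bdd_above Lo" using \<open>P gs0 1\<close> one_closed unfolding bdd_above_def by blast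
  have "\<bar>ravg gs f x - Sup Lo\<bar> \<le> c" if "P gs c" "x \<in> carrier G" for gs c x
  proof -
    have "ravg gs f x - c \<le> Sup Lo"
      using that bdd by (intro cSup_upper) (auto simp: Lo_def)
    moreover have "Sup Lo \<le> ravg gs f x + c"
      using that Lo0 up by (intro cSup_least) auto
    ultimately show ?thesis by linarith
  qed
  then show ?thesis unfolding P_def by blast
qed

text \<open>The normalised Haar integral on Lipschitz functions. For these the value exists by
  \<open>mean_exists\<close> and is unique, since right averages of arbitrarily small oscillation
  exist.\<close>

definition mean :: "('a \<Rightarrow> real) \<Rightarrow> real" where
  "mean f = (SOME m. \<forall>gs c. nlist gs \<longrightarrow> osc_le (ravg gs f) c \<longrightarrow>
     (\<forall>x\<in>carrier G. \<bar>ravg gs f x - m\<bar> \<le> c))"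

text \<open>One list for finitely many functions: identities and inequalities of finite averages
  pass to the mean through it.\<close>

lemma mean_approx:
  assumes "finite S" "\<And>f. f \<in> S \<Longrightarrow> lip f" "c > 0"
  obtains gs where "nlist gs" "\<And>f x. f \<in> S \<Longrightarrow> x \<in> carrier G \<Longrightarrow> \<bar>ravg gs f x - mean f\<bar> \<le> c"
proof -
  obtain gs where gs: "nlist gs" "\<forall>f\<in>S. osc_le (ravg gs f) c"
    using ravg_small_osc_family[OF assms] by blast
  have "\<bar>ravg gs f x - mean f\<bar> \<le> c" if "f \<in> S" "x \<in> carrier G" for f x
    using someI_ex[OF mean_exists[OF assms(2)[OF that(1)]]] gs that unfolding mean_def by blast
  with gs(1) show thesis by (rule that)
qed

section \<open>Order, linearity, invariance, positivity and Fubini for the mean\<close>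

lemma mean_mono:
  assumes "lip f" "lip g" "\<And>x. x \<in> carrier G \<Longrightarrow> f x \<le> g x"
  shows "mean f \<le> mean g"
proof (rule field_le_epsilon)
  fix e :: real assume e: "e > 0"
  obtain gs where gs: "nlist gs" "\<And>h x. h \<in> {f, g} \<Longrightarrow> x \<in> carrier G \<Longrightarrow> \<bar>ravg gs h x - mean h\<bar> \<le> e / 2"
    using mean_approx[of "{f, g}" "e / 2"] assms e by auto
  have "avg gs (\<lambda>y. f (\<one> \<otimes> y) - g (\<one> \<otimes> y)) \<le> 0"
    using gs(1) assms(3) unfolding nlist_def by (intro avg_le) auto
  then have "ravg gs f \<one> \<le> ravg gs g \<one>"
    unfolding avg_diff ravg_def by simp
  then show "mean f \<le> mean g + e"
    using gs(2)[OF insertI1 one_closed] gs(2)[OF insertI2[OF insertI1] one_closed] by linarith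
qed

lemma mean_cong:
  assumes "lip f" "lip g" "\<And>x. x \<in> carrier G \<Longrightarrow> f x = g x"
  shows "mean f = mean g"
  using mean_mono[OF assms(1,2)] mean_mono[OF assms(2,1)] assms(3) by (simp add: order_antisym)

lemma mean_add:
  assumes "lip f" "lip g"
  shows "mean (\<lambda>x. f x + g x) = mean f + mean g"
proof -
  have "\<bar>mean (\<lambda>x. f x + g x) - (mean f + mean g)\<bar> \<le> e" if e: "e > 0" for e
  proof -
    let ?h = "\<lambda>x. f x + g x"
    obtain gs where gs: "nlist gs"
      "\<And>h x. h \<in> {f, g, ?h} \<Longrightarrow> x \<in> carrier G \<Longrightarrow> \<bar>ravg gs h x - mean h\<bar> \<le> e / 3"
      using mean_approx[of "{f, g, ?h}" "e / 3"] assms e by auto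
    have "ravg gs ?h \<one> = ravg gs f \<one> + ravg gs g \<one>"
      unfolding ravg_def avg_add ..
    then show ?thesis
      using gs(2)[OF insertI1 one_closed] gs(2)[OF insertI2[OF insertI1] one_closed]
        gs(2)[OF insertI2[OF insertI2[OF insertI1]] one_closed] by linarith
  qed
  then show ?thesis by (meson abs_le_zero_iff dense_ge eq_iff_diff_eq_0)
qed

lemma mean_cmult:
  assumes "lip f"
  shows "mean (\<lambda>x. c * f x) = c * mean f"
proof -
  have "\<bar>mean (\<lambda>x. c * f x) - c * mean f\<bar> \<le> e" if e: "e > 0" for e
  proof -
    let ?h = "\<lambda>x. c * f x"
    obtain gs where gs: "nlist gs"
      "\<And>h x. h \<in> {f, ?h} \<Longrightarrow> x \<in> carrier G \<Longrightarrow> \<bar>ravg gs h x - mean h\<bar> \<le> e / (1 + \<bar>c\<bar>)"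
      using mean_approx[of "{f, ?h}" "e / (1 + \<bar>c\<bar>)"] assms e by auto
    have "ravg gs ?h \<one> = c * ravg gs f \<one>"
      unfolding ravg_def avg_mult ..
    then have "\<bar>mean ?h - c * mean f\<bar> \<le> \<bar>ravg gs ?h \<one> - mean ?h\<bar> + \<bar>c * (ravg gs f \<one> - mean f)\<bar>"
      unfolding right_diff_distrib by linarith
    also have "\<dots> \<le> e / (1 + \<bar>c\<bar>) + \<bar>c\<bar> * (e / (1 + \<bar>c\<bar>))"
      unfolding abs_mult using gs(2)[of f \<one>] gs(2)[of ?h \<one>] by (intro add_mono mult_left_mono) auto
    also have "\<dots> = (1 + \<bar>c\<bar>) * (e / (1 + \<bar>c\<bar>))" unfolding distrib_right by simp
    also have "\<dots> = e" using abs_ge_zero[of c] by simp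
    finally show ?thesis .
  qed
  then show ?thesis by (meson abs_le_zero_iff dense_ge eq_iff_diff_eq_0)
qed

lemma mean_diff:
  assumes "lip f" "lip g"
  shows "mean (\<lambda>x. f x - g x) = mean f - mean g"
  using mean_add[OF assms(1) lip_cmult[OF assms(2), of "-1"]] mean_cmult[OF assms(2), of "-1"] by simp

lemma mean_const: "mean (\<lambda>_. c) = c"
proof -
  have "\<bar>mean (\<lambda>_. c) - c\<bar> \<le> e" if e: "e > 0" for e
  proof -
    obtain gs where gs: "nlist gs"
      "\<And>h x. h \<in> {\<lambda>_. c} \<Longrightarrow> x \<in> carrier G \<Longrightarrow> \<bar>ravg gs h x - mean h\<bar> \<le> e"
      using mean_approx[of "{\<lambda>_. c}" e] e by auto
    then show ?thesis using gs(2)[of "\<lambda>_. c" \<one>] unfolding nlist_def ravg_def by (simp add: avg_const)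
  qed
  then show ?thesis by (meson abs_le_zero_iff dense_ge eq_iff_diff_eq_0)
qed

text \<open>The right average of the translate at the identity is the right average of
  \<open>f\<close> at \<open>a\<close>, and such averages are close to \<open>mean f\<close> at
  every point.\<close>

lemma mean_left:
  assumes "lip f" "a \<in> carrier G"
  shows "mean (\<lambda>x. f (a \<otimes> x)) = mean f"
proof -
  have "\<bar>mean (\<lambda>x. f (a \<otimes> x)) - mean f\<bar> \<le> e" if e: "e > 0" for e
  proof -
    let ?h = "\<lambda>x. f (a \<otimes> x)"
    obtain gs where gs: "nlist gs"
      "\<And>h x. h \<in> {f, ?h} \<Longrightarrow> x \<in> carrier G \<Longrightarrow> \<bar>ravg gs h x - mean h\<bar> \<le> e / 2"
      using mean_approx[of "{f, ?h}" "e / 2"] assms lip_left[OF assms] e by auto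
    have "ravg gs ?h \<one> = ravg gs f a"
      unfolding ravg_def using gs(1) assms(2) by (intro avg_cong) (auto simp: nlist_def subset_iff)
    then show ?thesis
      using gs(2)[OF insertI1 assms(2)] gs(2)[OF insertI2[OF insertI1] one_closed] by linarith
  qed
  then show ?thesis by (meson abs_le_zero_iff dense_ge eq_iff_diff_eq_0)
qed

lemma mean_le: "lip f \<Longrightarrow> (\<And>x. x \<in> carrier G \<Longrightarrow> f x \<le> b) \<Longrightarrow> mean f \<le> b"
  using mean_mono[of f "\<lambda>_. b"] by (simp add: mean_const)

lemma mean_ge: "lip f \<Longrightarrow> (\<And>x. x \<in> carrier G \<Longrightarrow> b \<le> f x) \<Longrightarrow> b \<le> mean f"
  using mean_mono[of "\<lambda>_. b" f] by (simp add: mean_const)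

lemma mean_abs_le:
  assumes "lip f" "\<And>x. x \<in> carrier G \<Longrightarrow> \<bar>f x\<bar> \<le> b" shows "\<bar>mean f\<bar> \<le> b"
  using mean_le[OF assms(1), of b] mean_ge[OF assms(1), of "- b"] assms(2) by (force simp: abs_le_iff)

lemma mean_sum_list:
  "(\<And>g. g \<in> set gs \<Longrightarrow> lip (F g)) \<Longrightarrow> mean (\<lambda>x. \<Sum>g\<leftarrow>gs. F g x) = (\<Sum>g\<leftarrow>gs. mean (F g))"
  by (induction gs) (auto simp: mean_const mean_add lip_sum_list)

text \<open>Finitely many left translates of \<open>f\<close> add up to at least
  \<open>f p / 2\<close> everywhere: for each \<open>x\<close> some net element \<open>g\<close>
  puts \<open>g \<otimes> x\<close> near \<open>p\<close>. By invariance the mean of this sum is a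
  multiple of \<open>mean f\<close>.\<close>

lemma mean_pos:
  assumes "lip f" "\<And>x. x \<in> carrier G \<Longrightarrow> 0 \<le> f x" "p \<in> carrier G" "f p > 0"
  shows "mean f > 0"
proof -
  obtain L where L: "L > 0" "lipc L f" by (rule lipE[OF assms(1)])
  obtain gs where gs: "gs \<noteq> []" "set gs \<subseteq> carrier G"
    "\<And>x. x \<in> carrier G \<Longrightarrow> \<exists>y\<in>set gs. D y x < f p / (2 * L)"
    using D_net_list[of "f p / (2 * L)"] L assms(4) by auto
  have "f p / 2 \<le> (\<Sum>g\<leftarrow>gs. f (g \<otimes> x))" if x: "x \<in> carrier G" for x
  proof -
    obtain g where g: "g \<in> set gs" "D g (p \<otimes> inv x) < f p / (2 * L)"
      using gs(3)[of "p \<otimes> inv x"] x assms(3) by auto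
    have gc: "g \<in> carrier G" using g gs by auto
    have "f p - f (g \<otimes> x) \<le> L * D (g \<otimes> x) p"
      using lipcD[OF L(2), of "g \<otimes> x" p] x gc assms(3) by auto
    also have "\<dots> \<le> f p / 2"
      using g(2) L x gc assms(3) by (auto simp: D_cancel_right field_simps)
    finally have "f p / 2 \<le> f (g \<otimes> x)" by linarith
    also have "\<dots> \<le> (\<Sum>g\<leftarrow>gs. f (g \<otimes> x))"
      using g gs x assms(2) by (intro member_le_sum_list) (auto simp: subset_iff)
    finally show ?thesis .
  qed
  then have "f p / 2 \<le> mean (\<lambda>x. \<Sum>g\<leftarrow>gs. f (g \<otimes> x))"
    using assms(1) gs by (intro mean_ge lip_sum_list lip_left) auto
  also have "\<dots> = (\<Sum>g\<leftarrow>gs. mean (\<lambda>x. f (g \<otimes> x)))"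
    using assms(1) gs by (intro mean_sum_list lip_left) auto
  also have "\<dots> = (\<Sum>g\<leftarrow>gs. mean f)"
    using assms(1) gs by (intro arg_cong[of _ _ sum_list] map_cong) (auto simp: mean_left subset_iff)
  finally have "0 < length gs * mean f"
    using assms(4) by (simp add: sum_list_triv)
  then show ?thesis by (simp add: zero_less_mult_iff)
qed

lemma mean_cauchy_schwarz:
  assumes "lip f" "lip g"
  shows "(mean (\<lambda>x. f x * g x))\<^sup>2 \<le> mean (\<lambda>x. f x * f x) * mean (\<lambda>x. g x * g x)"
proof (cases "\<exists>p\<in>carrier G. g p \<noteq> 0")
  case False
  then have "mean (\<lambda>x. f x * g x) = mean (\<lambda>_. 0)" "mean (\<lambda>x. g x * g x) = mean (\<lambda>_. 0)"
    using assms by (intro mean_cong; auto)+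
  then show ?thesis by (simp add: mean_const)
next
  case True
  then obtain p where "p \<in> carrier G" "g p \<noteq> 0" by blast
  then have c: "mean (\<lambda>x. g x * g x) > 0" (is "?c > 0")
    using assms by (intro mean_pos[of _ p]) (auto simp: zero_less_mult_iff)
  define a b t where "a = mean (\<lambda>x. f x * f x)" and "b = mean (\<lambda>x. f x * g x)" and "t = b / ?c"
  have "0 \<le> mean (\<lambda>x. (f x - t * g x) * (f x - t * g x))"
    using assms by (intro mean_ge lip_mult lip_diff lip_cmult) auto
  also have "(\<lambda>x. (f x - t * g x) * (f x - t * g x)) =
      (\<lambda>x. (f x * f x - (2 * t) * (f x * g x)) + t\<^sup>2 * (g x * g x))"
    by (auto simp: algebra_simps power2_eq_square)
  also have "mean \<dots> = (a - 2 * t * b) + t\<^sup>2 * ?c"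
    unfolding a_def b_def
    using assms by (subst mean_add mean_diff mean_cmult; (intro lip_diff lip_cmult lip_mult)?; simp)+
  finally have "0 \<le> a - b\<^sup>2 / ?c"
    using c unfolding t_def by (simp add: power2_eq_square field_simps)
  then show ?thesis using c unfolding a_def b_def by (simp add: field_simps)
qed

text \<open>Both iterated means are close to the same finite double average, whose order may be
  exchanged. The constant \<open>L\<close> common to all sections lets the sections at the points of
  a finite net represent all of them.\<close>

lemma mean_fubini:
  assumes "\<And>x. x \<in> carrier G \<Longrightarrow> lipc L (\<lambda>y. F x y)"
    and "\<And>y. y \<in> carrier G \<Longrightarrow> lipc L (\<lambda>x. F x y)"
  shows "lip (\<lambda>x. mean (\<lambda>y. F x y))"
    and "mean (\<lambda>x. mean (\<lambda>y. F x y)) = mean (\<lambda>y. mean (\<lambda>x. F x y))"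
proof -
  have marg: "lipc L (\<lambda>x. mean (\<lambda>y. H x y))"
    if 1: "\<And>x. x \<in> carrier G \<Longrightarrow> lipc L (\<lambda>y. H x y)"
      and 2: "\<And>y. y \<in> carrier G \<Longrightarrow> lipc L (\<lambda>x. H x y)" for H
    unfolding lipc_def
  proof (intro ballI)
    fix x x' assume x: "x \<in> carrier G" "x' \<in> carrier G"
    have "mean (\<lambda>y. H x y) - mean (\<lambda>y. H x' y) = mean (\<lambda>y. H x y - H x' y)"
      using mean_diff lipc_lip[OF 1] x by simp
    also have "\<bar>\<dots>\<bar> \<le> L * D x x'"
      using lipc_lip[OF 1] lipcD[OF 2] x by (intro mean_abs_le) auto
    finally show "\<bar>mean (\<lambda>y. H x y) - mean (\<lambda>y. H x' y)\<bar> \<le> L * D x x'" .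
  qed
  have l1: "lipc L (\<lambda>x. mean (\<lambda>y. F x y))" by (rule marg[OF assms])
  have l2: "lipc L (\<lambda>y. mean (\<lambda>x. F x y))" by (rule marg[OF assms(2,1)])
  show "lip (\<lambda>x. mean (\<lambda>y. F x y))" using l1 by (rule lipc_lip)
  \<comment> \<open>Replacing the inner average by the inner mean costs \<open>3 * e\<close>: one
    \<open>e\<close> at the net point and two for moving there and back. The outer average costs the
    fourth.\<close>
  have half: "\<bar>avg gs (\<lambda>x. avg gs (\<lambda>y. H x y)) - mean (\<lambda>x. mean (\<lambda>y. H x y))\<bar> \<le> 4 * e"
    if e: "e > 0" and H1: "\<And>x. x \<in> carrier G \<Longrightarrow> lipc L (\<lambda>y. H x y)"
      and H2: "\<And>y. y \<in> carrier G \<Longrightarrow> lipc L (\<lambda>x. H x y)"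
      and gs: "nlist gs" and N: "N \<subseteq> carrier G" "\<And>x. x \<in> carrier G \<Longrightarrow> \<exists>y\<in>N. D y x < e / (\<bar>L\<bar> + 1)"
      and A: "\<And>z. z \<in> N \<Longrightarrow> \<bar>avg gs (\<lambda>y. H z y) - mean (\<lambda>y. H z y)\<bar> \<le> e"
      and A': "\<bar>avg gs (\<lambda>x. mean (\<lambda>y. H x y)) - mean (\<lambda>x. mean (\<lambda>y. H x y))\<bar> \<le> e" for H e gs N
  proof -
    have "\<bar>avg gs (\<lambda>y. H x y) - mean (\<lambda>y. H x y)\<bar> \<le> 3 * e" if x: "x \<in> carrier G" for x
    proof -
      obtain z where z: "z \<in> N" "D z x < e / (\<bar>L\<bar> + 1)" using N(2)[OF x] by blast
      have zc: "z \<in> carrier G" using z N by auto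
      have "L * D z x \<le> (\<bar>L\<bar> + 1) * D z x"
        using D_nonneg[OF zc x] by (intro mult_right_mono) auto
      also have "\<dots> \<le> e" using z(2) by (simp add: field_simps add_pos_nonneg)
      finally have Le: "L * D z x \<le> e" .
      have "\<bar>avg gs (\<lambda>y. H z y) - avg gs (\<lambda>y. H x y)\<bar> \<le> e"
        using gs lipcD[OF H2 zc x] Le unfolding nlist_def by (intro avg_abs_le) (force simp: subset_iff)+
      moreover have "\<bar>mean (\<lambda>y. H z y) - mean (\<lambda>y. H x y)\<bar> \<le> e"
        using lipcD[OF marg[OF H1 H2] zc x] Le by simp
      ultimately show ?thesis using A[OF z(1)] by linarith
    qed
    then have "\<bar>avg gs (\<lambda>x. avg gs (\<lambda>y. H x y)) - avg gs (\<lambda>x. mean (\<lambda>y. H x y))\<bar> \<le> 3 * e"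
      using gs unfolding nlist_def by (intro avg_abs_le) auto
    then show ?thesis using A' by linarith
  qed
  have "\<bar>mean (\<lambda>x. mean (\<lambda>y. F x y)) - mean (\<lambda>y. mean (\<lambda>x. F x y))\<bar> \<le> e" if "e > 0" for e
  proof -
    define e' where "e' = e / 8"
    have e': "e' > 0" using that unfolding e'_def by simp
    obtain N where N: "finite N" "N \<subseteq> carrier G" "\<And>x. x \<in> carrier G \<Longrightarrow> \<exists>y\<in>N. D y x < e' / (\<bar>L\<bar> + 1)"
      using D_net[of "e' / (\<bar>L\<bar> + 1)"] e' by auto
    \<comment> \<open>All functions that must be averaged well by the same list: the sections in
      either variable at the net points, and both marginals.\<close>
    define S where "S = (\<lambda>z y. F z y) ` N \<union> (\<lambda>z x. F x z) ` N \<union>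
      {\<lambda>x. mean (\<lambda>y. F x y), \<lambda>y. mean (\<lambda>x. F x y)}"
    have "lip f" if "f \<in> S" for f
      using that N(2) lipc_lip[OF l1] lipc_lip[OF l2] lipc_lip[OF assms(1)] lipc_lip[OF assms(2)]
      unfolding S_def by auto
    then obtain gs where gs: "nlist gs"
      "\<And>f x. f \<in> S \<Longrightarrow> x \<in> carrier G \<Longrightarrow> \<bar>ravg gs f x - mean f\<bar> \<le> e'"
      using mean_approx[of S e'] N(1) e' unfolding S_def by auto
    have "ravg gs f \<one> = avg gs f" for f
      unfolding ravg_def using gs(1) by (intro avg_cong) (auto simp: nlist_def subset_iff)
    then have A: "\<bar>avg gs f - mean f\<bar> \<le> e'" if "f \<in> S" for f
      using gs(2)[OF that one_closed] by simp
    have "\<bar>avg gs (\<lambda>x. avg gs (\<lambda>y. F x y)) - mean (\<lambda>x. mean (\<lambda>y. F x y))\<bar> \<le> 4 * e'"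
      by (rule half[OF e' assms gs(1) N(2,3)]) (auto intro!: A simp: S_def)
    moreover have "\<bar>avg gs (\<lambda>y. avg gs (\<lambda>x. F x y)) - mean (\<lambda>y. mean (\<lambda>x. F x y))\<bar> \<le> 4 * e'"
      by (rule half[OF e' assms(2,1) gs(1) N(2,3)]) (auto intro!: A simp: S_def)
    ultimately show ?thesis
      using avg_swap[of gs gs F] unfolding e'_def by linarith
  qed
  then show "mean (\<lambda>x. mean (\<lambda>y. F x y)) = mean (\<lambda>y. mean (\<lambda>x. F x y))"
    by (meson abs_le_zero_iff dense_ge eq_iff_diff_eq_0)
qed

text \<open>An Arzela-Ascoli argument without subsequences: compactness of a product of intervals
  gives a pointwise cluster point, and the common Lipschitz constant makes closeness on a finite net
  uniform.\<close>

lemma lipc_cluster_function: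
  fixes w :: "nat \<Rightarrow> 'a \<Rightarrow> real"
  assumes L: "\<And>n. lipc L (w n)" and B: "\<And>n x. x \<in> carrier G \<Longrightarrow> \<bar>w n x\<bar> \<le> B"
  obtains v where "lipc L v" "\<And>e N. e > 0 \<Longrightarrow> \<exists>n\<ge>N. \<forall>x\<in>carrier G. \<bar>w n x - v x\<bar> < e"
proof -
  \<comment> \<open>The product runs over the whole type, so the functions are set to 0 outside the
    carrier to keep all values in the interval.\<close>
  define w' where "w' n x = (if x \<in> carrier G then w n x else 0)" for n x
  define C :: "('a \<Rightarrow> real) set" where "C = PiE UNIV (\<lambda>_. {- B..B})"
  have B0: "0 \<le> B" using B[OF one_closed, of 0] by linarith
  have "compactin (product_topology (\<lambda>_. euclidean) UNIV) C"
    unfolding C_def by (subst compactin_PiE) auto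
  then have C: "compact C" unfolding euclidean_product_topology by simp
  have "- B \<le> w' n x \<and> w' n x \<le> B" for n x
  proof (cases "x \<in> carrier G")
    case True
    then show ?thesis using B[OF True, of n] unfolding w'_def by (simp add: abs_le_iff)
  qed (use B0 in \<open>simp add: w'_def\<close>)
  then have "w' n \<in> C" for n unfolding C_def by (simp add: PiE_iff)
  then have "eventually (\<lambda>f. f \<in> C) (filtermap w' sequentially)"
    by (simp add: eventually_filtermap)
  moreover have "filtermap w' sequentially \<noteq> bot" by (simp add: filtermap_bot_iff)
  moreover have "filtermap w' sequentially \<le> principal C"
    using calculation(1) by (simp add: le_principal)
  ultimately obtain v where v: "inf (nhds v) (filtermap w' sequentially) \<noteq> bot"
    using C unfolding compact_filter by blast
  \<comment> \<open>Otherwise the sequence would eventually leave the product neighbourhood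
    \<open>U\<close> of \<open>v\<close>, which a cluster point forbids.\<close>
  have near: "\<exists>n\<ge>N. \<forall>x\<in>X. \<bar>w n x - v x\<bar> < e" if X: "finite X" "X \<subseteq> carrier G" and e: "e > 0" for X e N
  proof (rule ccontr)
    assume "\<not> ?thesis"
    then have no: "\<exists>x\<in>X. \<not> \<bar>w n x - v x\<bar> < e" if "n \<ge> N" for n using that by blast
    define U where "U = (\<Inter>x\<in>X. {f. \<bar>f x - v x\<bar> < e})"
    have "open {f. \<bar>f x - v x\<bar> < e}" for x
      by (intro open_Collect_less continuous_intros) (auto intro: continuous_on_product_coordinates)
    then have "open U" unfolding U_def using X(1) by (intro open_INT) auto
    moreover have "v \<in> U" using e unfolding U_def by simp
    ultimately have "eventually (\<lambda>f. f \<in> U) (nhds v)" by (rule eventually_nhds_in_open)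
    moreover have "eventually (\<lambda>f. f \<notin> U) (filtermap w' sequentially)"
      unfolding eventually_filtermap eventually_sequentially
    proof (intro exI allI impI)
      fix n assume "n \<ge> N"
      then obtain x where "x \<in> X" "\<not> \<bar>w n x - v x\<bar> < e" using no by blast
      then show "w' n \<notin> U" using X(2) unfolding U_def w'_def by auto
    qed
    ultimately have "eventually (\<lambda>f. False) (inf (nhds v) (filtermap w' sequentially))"
      unfolding eventually_inf by (intro exI[of _ "\<lambda>f. f \<in> U"] exI[of _ "\<lambda>f. f \<notin> U"]) simp
    then show False using v by (simp add: eventually_False)
  qed
  have lv: "lipc L v"
    unfolding lipc_def
  proof (intro ballI, rule field_le_epsilon)
    fix x y and e :: real assume xy: "x \<in> carrier G" "y \<in> carrier G" and e: "0 < e"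
    obtain n where "\<forall>z\<in>{x, y}. \<bar>w n z - v z\<bar> < e / 2"
      using near[of "{x, y}" "e / 2" 0] xy e by auto
    then have "\<bar>w n x - v x\<bar> < e / 2" "\<bar>w n y - v y\<bar> < e / 2" by auto
    then show "\<bar>v x - v y\<bar> \<le> L * D x y + e"
      using lipcD[OF L[of n] xy] by linarith
  qed
  have "\<exists>n\<ge>N. \<forall>x\<in>carrier G. \<bar>w n x - v x\<bar> < e" if e: "e > 0" for e N
  proof -
    define c where "c = \<bar>L\<bar> + 1"
    have c: "c > 0" "L \<le> c" unfolding c_def by linarith+
    \<comment> \<open>Moving to the net point costs at most \<open>e / 4\<close> for
      \<open>w n\<close> and for \<open>v\<close>, leaving \<open>e / 2\<close> for the error
      there.\<close>
    define d where "d = e / (4 * c)"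
    have d: "d > 0" using e c unfolding d_def by simp
    obtain X where X: "finite X" "X \<subseteq> carrier G" "\<forall>x\<in>carrier G. \<exists>y\<in>X. D y x < d"
      using D_net[OF d] by blast
    obtain n where n: "n \<ge> N" "\<forall>x\<in>X. \<bar>w n x - v x\<bar> < e / 2"
      using near[of X "e / 2" N] X e by auto
    have "\<bar>w n x - v x\<bar> < e" if x: "x \<in> carrier G" for x
    proof -
      obtain y where y: "y \<in> X" "D y x < d" using X x by blast
      have yc: "y \<in> carrier G" using y X by auto
      have "L * D y x \<le> c * D y x"
        using D_nonneg[OF yc x] c by (intro mult_right_mono) auto
      also have "\<dots> \<le> c * d" using y c by (intro mult_left_mono) auto
      also have "\<dots> = e / 4" using c unfolding d_def by simp
      finally have "L * D y x \<le> e / 4" .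
      then show ?thesis
        using lipcD[OF L[of n] yc x] lipcD[OF lv yc x] bspec[OF n(2) y(1)] by linarith
    qed
    with n(1) show ?thesis by blast
  qed
  with lv show thesis by (rule that)
qed

section \<open>The averaging operator and its eigenfunctions\<close>

text \<open>A tent around the diagonal: symmetric, 1-Lipschitz in each variable, and unchanged when
  both arguments are translated by the same element.\<close>

definition kern :: "real \<Rightarrow> 'a \<Rightarrow> 'a \<Rightarrow> real" where
  "kern r x y = max 0 (r - D x y)"

definition kop :: "real \<Rightarrow> ('a \<Rightarrow> real) \<Rightarrow> 'a \<Rightarrow> real" where
  "kop r v x = mean (\<lambda>y. kern r x y * v y)"

lemma kern_nonneg: "0 \<le> kern r x y"
  unfolding kern_def by simp

lemma kern_le: "r > 0 \<Longrightarrow> x \<in> carrier G \<Longrightarrow> y \<in> carrier G \<Longrightarrow> kern r x y \<le> r"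
  unfolding kern_def using D_nonneg[of x y] by simp

lemma kern_sym: "x \<in> carrier G \<Longrightarrow> y \<in> carrier G \<Longrightarrow> kern r x y = kern r y x"
  unfolding kern_def using D_sym[of x y] by simp

lemma lipc_kern: "x \<in> carrier G \<Longrightarrow> lipc 1 (kern r x)"
  unfolding lipc_def
proof (intro ballI)
  fix y z assume *: "x \<in> carrier G" "y \<in> carrier G" "z \<in> carrier G"
  show "\<bar>kern r x y - kern r x z\<bar> \<le> 1 * D y z"
    using D_triangle[of x y z] D_triangle[of x z y] D_sym[of y z] * unfolding kern_def by auto
qed

lemma kern_diff_le:
  "x \<in> carrier G \<Longrightarrow> x' \<in> carrier G \<Longrightarrow> y \<in> carrier G \<Longrightarrow> \<bar>kern r x y - kern r x' y\<bar> \<le> D x x'"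
  using lipcD[OF lipc_kern[of y r], of x x'] kern_sym by simp

lemma lip_kern [intro]: "x \<in> carrier G \<Longrightarrow> lip (kern r x)"
  using lipc_kern lipc_lip by blast

lemma lip_kern_mult [intro]: "x \<in> carrier G \<Longrightarrow> lip v \<Longrightarrow> lip (\<lambda>y. kern r x y * v y)"
  by (intro lip_mult lip_kern)

lemma kop_diff_eq:
  assumes "lip v" "x \<in> carrier G" "x' \<in> carrier G"
  shows "kop r v x - kop r v x' = mean (\<lambda>y. (kern r x y - kern r x' y) * v y)"
  unfolding kop_def using assms
  by (subst mean_diff[symmetric]) (auto simp: left_diff_distrib)

lemma kop_abs_le:
  assumes "r > 0" "lip v" "\<And>x. x \<in> carrier G \<Longrightarrow> \<bar>v x\<bar> \<le> B" "x \<in> carrier G"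
  shows "\<bar>kop r v x\<bar> \<le> r * B"
  unfolding kop_def using assms kern_nonneg[of r] kern_le[of r]
  by (intro mean_abs_le lip_kern_mult) (auto simp: abs_mult intro!: mult_mono)

text \<open>Smoothing: the Lipschitz constant comes from the kernel alone, so it depends on the size
  of \<open>v\<close> and not on its own Lipschitz constant.\<close>

lemma lipc_kop:
  assumes "lip v" "\<And>x. x \<in> carrier G \<Longrightarrow> \<bar>v x\<bar> \<le> B"
  shows "lipc B (kop r v)"
  unfolding lipc_def
proof (intro ballI)
  fix x x' assume x: "x \<in> carrier G" "x' \<in> carrier G"
  have "\<bar>mean (\<lambda>y. (kern r x y - kern r x' y) * v y)\<bar> \<le> D x x' * B"
    using assms x kern_diff_le[OF x] D_nonneg
    by (intro mean_abs_le lip_mult lip_diff lip_kern) (auto simp: abs_mult intro!: mult_mono)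
  then show "\<bar>kop r v x - kop r v x'\<bar> \<le> B * D x x'"
    using kop_diff_eq[OF assms(1) x] by (simp add: mult.commute)
qed

lemma lip_kop [intro]:
  assumes "lip v" shows "lip (kop r v)"
  using lip_bounded[OF assms] lipc_kop[OF assms] lipc_lip by metis

section \<open>Mean-square estimates and self-adjointness\<close>

abbreviation ip :: "('a \<Rightarrow> real) \<Rightarrow> ('a \<Rightarrow> real) \<Rightarrow> real" where
  "ip f g \<equiv> mean (\<lambda>x. f x * g x)"

lemma ip_nonneg: "lip f \<Longrightarrow> 0 \<le> ip f f"
  by (intro mean_ge) auto

text \<open>Cauchy-Schwarz. Applied to the kernel and to its differences, it shows that the operator
  maps a mean-square ball to a uniformly bounded, equi-Lipschitz family, which is its
  compactness.\<close>

lemma ip_bounded_le: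
  assumes "lip k" "lip v" "c \<ge> 0" "\<And>y. y \<in> carrier G \<Longrightarrow> \<bar>k y\<bar> \<le> c"
  shows "\<bar>ip k v\<bar> \<le> c * sqrt (ip v v)"
proof -
  have "k y * k y \<le> c * c" if "y \<in> carrier G" for y
    using assms(3) assms(4)[OF that] by (metis abs_mult_self_eq abs_ge_zero mult_mono)
  then have "ip k k \<le> c * c"
    using assms(1) by (intro mean_le) auto
  then have "\<bar>ip k v\<bar>\<^sup>2 \<le> c * c * ip v v"
    using mean_cauchy_schwarz[OF assms(1,2)] ip_nonneg[OF assms(2)]
    by (simp, meson mult_right_mono order_trans)
  also have "\<dots> = (c * sqrt (ip v v))\<^sup>2"
    using ip_nonneg[OF assms(2)] by (simp add: power_mult_distrib power2_eq_square)
  finally show ?thesis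
    by (rule power2_le_imp_le) (use assms(3) ip_nonneg[OF assms(2)] in auto)
qed

lemma kop_abs_le_ip:
  assumes "r > 0" "lip v" "x \<in> carrier G"
  shows "\<bar>kop r v x\<bar> \<le> r * sqrt (ip v v)"
  unfolding kop_def using assms kern_nonneg[of r x] kern_le[of r x]
  by (intro ip_bounded_le lip_kern) auto

lemma lipc_kop_ip:
  assumes "lip v" shows "lipc (sqrt (ip v v)) (kop r v)"
  unfolding lipc_def
proof (intro ballI)
  fix x x' assume x: "x \<in> carrier G" "x' \<in> carrier G"
  show "\<bar>kop r v x - kop r v x'\<bar> \<le> sqrt (ip v v) * D x x'"
    unfolding kop_diff_eq[OF assms x] mult.commute[of "sqrt (ip v v)"]
    using assms x kern_diff_le[OF x] D_nonneg by (intro ip_bounded_le lip_diff lip_kern) auto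
qed

lemma kop_cong:
  assumes "lip f" "lip g" "\<And>x. x \<in> carrier G \<Longrightarrow> f x = g x" "x \<in> carrier G"
  shows "kop r f x = kop r g x"
  unfolding kop_def using assms by (intro mean_cong) auto

lemma kop_cmult:
  assumes "lip f" "x \<in> carrier G"
  shows "kop r (\<lambda>y. c * f y) x = c * kop r f x"
  unfolding kop_def using mean_cmult[OF lip_kern_mult[OF assms(2,1)], of c] by (simp add: mult_ac)

lemma kop_diff:
  assumes "lip f" "lip g" "x \<in> carrier G"
  shows "kop r (\<lambda>y. f y - g y) x = kop r f x - kop r g x"
  unfolding kop_def using mean_diff[OF lip_kern_mult[OF assms(3,1)] lip_kern_mult[OF assms(3,2)]]
  by (simp add: right_diff_distrib)

text \<open>The substitution of \<open>a \<otimes> y\<close> for \<open>y\<close> is allowed by the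
  left invariance of the mean, and the kernel absorbs it by that of \<open>D\<close>.\<close>

lemma kop_left:
  assumes "lip v" "a \<in> carrier G" "x \<in> carrier G"
  shows "kop r (\<lambda>y. v (a \<otimes> y)) x = kop r v (a \<otimes> x)"
proof -
  have l: "lip (\<lambda>y. kern r (a \<otimes> x) y * v y)"
    using assms by (intro lip_kern_mult) auto
  have "kop r (\<lambda>y. v (a \<otimes> y)) x = mean (\<lambda>y. kern r (a \<otimes> x) (a \<otimes> y) * v (a \<otimes> y))"
    unfolding kop_def
  proof (rule mean_cong[OF lip_kern_mult[OF assms(3) lip_left[OF assms(1,2)]] lip_left[OF l assms(2)]])
    show "kern r x y * v (a \<otimes> y) = kern r (a \<otimes> x) (a \<otimes> y) * v (a \<otimes> y)" if "y \<in> carrier G" for y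
      using assms that by (simp add: kern_def D_left)
  qed
  also have "\<dots> = kop r v (a \<otimes> x)"
    unfolding kop_def by (rule mean_left[OF l assms(2)])
  finally show ?thesis .
qed

text \<open>A case of commuting with left translations. It makes the functions of mean zero
  invariant under the operator.\<close>

lemma kop_one: "x \<in> carrier G \<Longrightarrow> kop r (\<lambda>_. 1) x = kop r (\<lambda>_. 1) \<one>"
  using kop_left[of "\<lambda>_. 1" x \<one> r] by simp

text \<open>Fubini and the symmetry of the kernel. The work lies in a Lipschitz constant for the
  sections that does not depend on the fixed variable.\<close>

lemma kop_self_adjoint:
  assumes r: "r > 0" and f: "lip f" and g: "lip g"
  shows "ip (kop r f) g = ip f (kop r g)"
proof -
  have bnd: "\<exists>L. \<forall>x\<in>carrier G. lipc L (\<lambda>y. kern r x y * f y * g x)" if f: "lip f" and g: "lip g" for f g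
  proof -
    obtain L where L: "L > 0" "lipc L f" by (rule lipE[OF f])
    obtain B where B: "B > 0" "\<And>x. x \<in> carrier G \<Longrightarrow> \<bar>f x\<bar> \<le> B" using lip_bounded[OF f] by blast
    obtain C where C: "C > 0" "\<And>x. x \<in> carrier G \<Longrightarrow> \<bar>g x\<bar> \<le> C" using lip_bounded[OF g] by blast
    have "\<bar>kern r x y * f y * g x - kern r x z * f z * g x\<bar> \<le> ((r * L + B) * C) * D y z"
      if x: "x \<in> carrier G" and y: "y \<in> carrier G" and z: "z \<in> carrier G" for x y z
    proof -
      have "\<bar>kern r x y * (f y - f z)\<bar> \<le> r * (L * D y z)"
        unfolding abs_mult using kern_le[OF r x y] kern_nonneg[of r x y] lipcD[OF L(2) y z] r
        by (intro mult_mono) auto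
      moreover have "\<bar>(kern r x y - kern r x z) * f z\<bar> \<le> D y z * B"
        unfolding abs_mult using lipcD[OF lipc_kern[OF x] y z, of r] B(2)[OF z] D_nonneg[OF y z]
        by (intro mult_mono) auto
      ultimately have "\<bar>kern r x y * (f y - f z) + (kern r x y - kern r x z) * f z\<bar> \<le> (r * L + B) * D y z"
        by (simp add: algebra_simps)
      then have "\<bar>kern r x y * (f y - f z) + (kern r x y - kern r x z) * f z\<bar> * \<bar>g x\<bar> \<le> ((r * L + B) * D y z) * C"
        using C(2)[OF x] r L B D_nonneg[OF y z] by (intro mult_mono) auto
      moreover have "kern r x y * f y * g x - kern r x z * f z * g x =
          (kern r x y * (f y - f z) + (kern r x y - kern r x z) * f z) * g x"
        by (simp add: algebra_simps)
      ultimately show ?thesis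
        by (simp only: abs_mult mult_ac)
    qed
    then show ?thesis unfolding lipc_def by (intro exI[of _ "(r * L + B) * C"] ballI)
  qed
  define F where "F x y = kern r x y * f y * g x" for x y
  obtain L1 where L1: "\<forall>x\<in>carrier G. lipc L1 (\<lambda>y. kern r x y * f y * g x)" using bnd[OF f g] ..
  obtain L2 where L2: "\<forall>x\<in>carrier G. lipc L2 (\<lambda>y. kern r x y * g y * f x)" using bnd[OF g f] ..
  define L where "L = max L1 L2"
  have 1: "lipc L (\<lambda>y. F x y)" if "x \<in> carrier G" for x
    unfolding F_def L_def using L1 that by (auto intro: lipc_mono[of L1])
  \<comment> \<open>The sections in the other variable have the same shape with \<open>f\<close> and
    \<open>g\<close> exchanged, because the kernel is symmetric.\<close>
  have 2: "lipc L (\<lambda>x. F x y)" if y: "y \<in> carrier G" for y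
  proof -
    have "lipc L (\<lambda>x. kern r y x * g x * f y)"
      unfolding L_def using L2 y by (auto intro: lipc_mono[of L2])
    then show ?thesis
      using y unfolding lipc_def F_def by (simp add: kern_sym mult_ac)
  qed
  have lF: "lip (\<lambda>x. mean (\<lambda>y. F x y))" by (rule mean_fubini(1)[OF 1 2])
  have lF': "lip (\<lambda>y. mean (\<lambda>x. F x y))" by (rule mean_fubini(1)[OF 2 1])
  have "ip (kop r f) g = mean (\<lambda>x. mean (\<lambda>y. F x y))"
  proof (rule mean_cong[OF _ lF])
    show "kop r f x * g x = mean (\<lambda>y. F x y)" if "x \<in> carrier G" for x
      using mean_cmult[OF lip_kern_mult[OF that f], of "g x" r] unfolding kop_def F_def by (simp add: mult_ac)
  qed (use f g in auto)
  also have "\<dots> = mean (\<lambda>y. mean (\<lambda>x. F x y))"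
    by (rule mean_fubini(2)[OF 1 2])
  also have "\<dots> = ip f (kop r g)"
  proof (rule mean_cong[OF lF'])
    fix y assume y: "y \<in> carrier G"
    have "mean (\<lambda>x. F x y) = mean (\<lambda>x. f y * (kern r y x * g x))"
      using y g lipc_lip[OF 2[OF y]] by (intro mean_cong) (auto simp: F_def kern_sym)
    then show "mean (\<lambda>x. F x y) = f y * kop r g y"
      using mean_cmult[OF lip_kern_mult[OF y g], of "f y" r] unfolding kop_def by simp
  qed (use f g in auto)
  finally show ?thesis .
qed

text \<open>Self-adjointness moves the operator onto the constant 1, whose image is
  constant.\<close>

lemma mean_kop:
  assumes "r > 0" "lip f" "mean f = 0"
  shows "mean (kop r f) = 0"
proof -
  have "mean (kop r f) = ip f (kop r (\<lambda>_. 1))"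
    using kop_self_adjoint[OF assms(1,2) lip_const[of 1]] by simp
  also have "\<dots> = mean (\<lambda>x. kop r (\<lambda>_. 1) \<one> * f x)"
  proof (rule mean_cong)
    show "f x * kop r (\<lambda>_. 1) x = kop r (\<lambda>_. 1) \<one> * f x" if "x \<in> carrier G" for x
      using kop_one[OF that, of r] by (metis mult.commute)
  qed (intro lip_mult lip_cmult lip_kop lip_const assms)+
  finally show ?thesis using assms by (simp add: mean_cmult)
qed

lemma kop_ip_le:
  assumes "r > 0" "lip v"
  shows "ip (kop r v) (kop r v) \<le> r\<^sup>2 * ip v v"
proof (rule mean_le)
  fix x assume x: "x \<in> carrier G"
  have "kop r v x * kop r v x = \<bar>kop r v x\<bar> * \<bar>kop r v x\<bar>" by simp
  also have "\<dots> \<le> (r * sqrt (ip v v)) * (r * sqrt (ip v v))"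
    using kop_abs_le_ip[OF assms x] ip_nonneg[OF assms(2)] assms(1) by (intro mult_mono) auto
  also have "\<dots> = r\<^sup>2 * ip v v"
    using ip_nonneg[OF assms(2)] by (simp add: power2_eq_square mult_ac)
  finally show "kop r v x * kop r v x \<le> r\<^sup>2 * ip v v" .
qed (use assms in auto)

text \<open>Power iteration: the ratios \<open>q n\<close> of the squared norms of consecutive iterates increase to
  the eigenvalue \<open>\<mu>\<close>, and the normalised iterates cluster at an eigenvector.\<close>
lemma kop_eigenvector:
  assumes r: "r > 0" and f: "lip f" and p: "p \<in> carrier G" "kop r f p \<noteq> 0" and m0: "mean f = 0"
  obtains w \<mu> where "lip w" "\<mu> > 0" "\<And>x. x \<in> carrier G \<Longrightarrow> kop r (kop r w) x = \<mu> * w x"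
    "mean w = 0" "\<exists>x\<in>carrier G. w x \<noteq> 0"
proof -
  define F where "F n = (kop r ^^ n) f" for n
  have F_Suc: "F (Suc n) = kop r (F n)" for n unfolding F_def by simp
  have lF: "lip (F n)" for n
  proof (induction n)
    case 0 then show ?case using f unfolding F_def by simp
  next
    case (Suc n) then show ?case unfolding F_Suc by blast
  qed
  have mF: "mean (F n) = 0" for n
  proof (induction n)
    case 0 then show ?case using m0 unfolding F_def by simp
  next
    case (Suc n) then show ?case unfolding F_Suc using mean_kop[OF r lF] by simp
  qed
  have lFF: "lip (\<lambda>x. F m x * F n x)" for m n by (rule lip_mult[OF lF lF])
  define a where "a n = ip (F n) (F n)" for n
  have a_nonneg: "a n \<ge> 0" for n unfolding a_def by (rule ip_nonneg[OF lF])
  \<comment> \<open>Self-adjointness shifts one application from the right factor to the left;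
    Cauchy-Schwarz then makes \<open>a\<close> log-convex, so the ratios increase.\<close>
  have a_Suc: "ip (F n) (F (Suc (Suc n))) = a (Suc n)" for n
    unfolding a_def using kop_self_adjoint[OF r lF[of n] lF[of "Suc n"]] by (simp add: F_Suc)
  have cs: "(a (Suc n))\<^sup>2 \<le> a n * a (Suc (Suc n))" for n
    using mean_cauchy_schwarz[OF lF[of n] lF[of "Suc (Suc n)"]] unfolding a_Suc by (simp add: a_def)
  have "a (Suc 0) > 0"
    unfolding a_def using p by (intro mean_pos[of _ p] lip_mult lF) (auto simp: F_def zero_less_mult_iff)
  then have a_pos_Suc: "a (Suc n) > 0" for n
  proof (induction n)
    case (Suc n)
    then have "0 < a (Suc n) * a (Suc n)" by simp
    then have "0 < a n * a (Suc (Suc n))" using cs[of n] by (simp add: power2_eq_square)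
    then show ?case using a_nonneg[of n] by (simp add: zero_less_mult_iff)
  qed simp
  have a_pos: "a n > 0" for n
  proof (cases n)
    case 0
    have "0 < a (Suc 0) * a (Suc 0)" using a_pos_Suc by simp
    then have "0 < a 0 * a (Suc (Suc 0))" using cs[of 0] by (simp add: power2_eq_square)
    then show ?thesis using a_nonneg[of "Suc (Suc 0)"] 0 by (simp add: zero_less_mult_iff)
  qed (use a_pos_Suc in auto)
  define q where "q n = a (Suc n) / a n" for n
  have q_pos: "q n > 0" for n unfolding q_def using a_pos by simp
  have q_inc: "q n \<le> q (Suc n)" for n
    using cs[of n] a_pos[of n] a_pos[of "Suc n"] unfolding q_def by (simp add: field_simps power2_eq_square)
  have q_le: "q n \<le> r\<^sup>2" for n
    using kop_ip_le[OF r lF[of n]] a_pos[of n] unfolding q_def a_def F_Suc by (simp add: field_simps)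
  have "incseq q" using q_inc by (rule incseq_SucI)
  then obtain \<mu> where \<mu>: "q \<longlonglongrightarrow> \<mu>" "\<And>n. q n \<le> \<mu>"
    using incseq_convergent[of q "r\<^sup>2"] q_le by blast
  have \<mu>_pos: "\<mu> > 0" using q_pos[of 0] \<mu>(2)[of 0] by linarith
  \<comment> \<open>Dividing by the norm of the preceding iterate, and not by its own, makes the
    smoothing estimates give the bound \<open>r\<close> and the Lipschitz constant 1, while the
    squared norm becomes \<open>q n\<close>.\<close>
  define w where "w n = (\<lambda>x. (1 / sqrt (a n)) * F (Suc n) x)" for n
  have lw: "lip (w n)" for n unfolding w_def by (intro lip_cmult lF)
  have w_lipc: "lipc 1 (w n)" for n
    unfolding lipc_def
  proof (intro ballI)
    fix x y assume "x \<in> carrier G" "y \<in> carrier G"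
    then have "\<bar>F (Suc n) x - F (Suc n) y\<bar> \<le> sqrt (a n) * D x y"
      using lipcD[OF lipc_kop_ip[OF lF[of n]], of x y r] unfolding F_Suc a_def by simp
    moreover have "\<bar>w n x - w n y\<bar> = \<bar>F (Suc n) x - F (Suc n) y\<bar> / sqrt (a n)"
      unfolding w_def using a_pos[of n] by (simp flip: diff_divide_distrib)
    ultimately show "\<bar>w n x - w n y\<bar> \<le> 1 * D x y"
      using a_pos[of n] by (simp add: divide_le_eq mult.commute)
  qed
  have w_bound: "\<bar>w n x\<bar> \<le> r" if "x \<in> carrier G" for n x
    using kop_abs_le_ip[OF r lF[of n] that] a_pos[of n]
    unfolding w_def F_Suc a_def by (simp add: divide_le_eq)
  have w_ip: "ip (w n) (w n) = q n" for n
  proof -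
    have "ip (w n) (w n) = mean (\<lambda>x. (1 / a n) * (F (Suc n) x * F (Suc n) x))"
      unfolding w_def using a_pos[of n] by (simp add: field_simps)
    also have "\<dots> = q n"
      unfolding q_def a_def by (subst mean_cmult[OF lip_mult[OF lF lF]]) simp
    finally show ?thesis .
  qed
  have w_mean: "mean (w n) = 0" for n
    unfolding w_def mean_cmult[OF lF] mF by simp
  have w_eig: "\<bar>kop r (kop r (w n)) x - \<mu> * w n x\<bar> \<le> r * sqrt (q (Suc n) * q n - 2 * \<mu> * q n + \<mu>\<^sup>2)"
    if x: "x \<in> carrier G" for n x
  proof -
    \<comment> \<open>The squared norm of \<open>u\<close>, divided by \<open>a n\<close>, tends to
      \<open>\<mu>\<^sup>2 - 2 * \<mu>\<^sup>2 + \<mu>\<^sup>2 = 0\<close>. One more application of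
      the operator turns this mean-square error into a uniform one.\<close>
    define u where "u = (\<lambda>x. F (Suc (Suc n)) x - \<mu> * F n x)"
    have lu: "lip u" unfolding u_def by (intro lip_diff lip_cmult lF)
    have "ip u u = mean (\<lambda>x. (F (Suc (Suc n)) x * F (Suc (Suc n)) x - (2 * \<mu>) * (F n x * F (Suc (Suc n)) x))
        + \<mu>\<^sup>2 * (F n x * F n x))"
      unfolding u_def by (rule arg_cong[of _ _ mean]) (auto simp: algebra_simps power2_eq_square)
    also have "\<dots> = (a (Suc (Suc n)) - 2 * \<mu> * a (Suc n)) + \<mu>\<^sup>2 * a n"
      by (simp only: mean_add[OF lip_diff[OF lFF lip_cmult[OF lFF]] lip_cmult[OF lFF]]
          mean_diff[OF lFF lip_cmult[OF lFF]] mean_cmult[OF lFF] a_Suc a_def[symmetric])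
    also have "\<dots> = a n * (q (Suc n) * q n - 2 * \<mu> * q n + \<mu>\<^sup>2)"
      using a_pos[of n] a_pos[of "Suc n"] unfolding q_def by (simp add: field_simps)
    finally have ipu: "ip u u = a n * (q (Suc n) * q n - 2 * \<mu> * q n + \<mu>\<^sup>2)" .
    have ku: "kop r u x = F (Suc (Suc (Suc n))) x - \<mu> * F (Suc n) x"
      unfolding u_def kop_diff[OF lF lip_cmult[OF lF] x] kop_cmult[OF lF x] by (simp add: F_Suc)
    have kw: "kop r (w n) y = (1 / sqrt (a n)) * F (Suc (Suc n)) y" if "y \<in> carrier G" for y
      unfolding w_def kop_cmult[OF lF that] F_Suc[symmetric] ..
    have "kop r (kop r (w n)) x = kop r (\<lambda>y. (1 / sqrt (a n)) * F (Suc (Suc n)) y) x"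
      by (rule kop_cong[OF lip_kop[OF lw] lip_cmult[OF lF] kw x])
    also have "\<dots> = (1 / sqrt (a n)) * kop r (F (Suc (Suc n))) x"
      by (rule kop_cmult[OF lF x])
    finally have kkw: "kop r (kop r (w n)) x = (1 / sqrt (a n)) * F (Suc (Suc (Suc n))) x"
      by (simp only: F_Suc)
    have "kop r (kop r (w n)) x - \<mu> * w n x = (1 / sqrt (a n)) * kop r u x"
      unfolding kkw ku unfolding w_def by (simp only: right_diff_distrib mult_ac)
    also have "\<bar>\<dots>\<bar> = (1 / sqrt (a n)) * \<bar>kop r u x\<bar>"
      using a_pos[of n] by (simp add: abs_mult)
    also have "\<dots> \<le> (1 / sqrt (a n)) * (r * sqrt (ip u u))"
      using kop_abs_le_ip[OF r lu x] a_pos[of n] by (intro mult_left_mono) auto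
    also have "\<dots> = r * sqrt (q (Suc n) * q n - 2 * \<mu> * q n + \<mu>\<^sup>2)"
      unfolding ipu real_sqrt_mult using a_pos[of n] by simp
    finally show ?thesis .
  qed
  have "(\<lambda>n. r * sqrt (q (Suc n) * q n - 2 * \<mu> * q n + \<mu>\<^sup>2)) \<longlonglongrightarrow> r * sqrt (\<mu> * \<mu> - 2 * \<mu> * \<mu> + \<mu>\<^sup>2)"
    using \<mu>(1) LIMSEQ_Suc[OF \<mu>(1)] by (intro tendsto_intros)
  then have lim0: "(\<lambda>n. r * sqrt (q (Suc n) * q n - 2 * \<mu> * q n + \<mu>\<^sup>2)) \<longlonglongrightarrow> 0"
    by (simp add: power2_eq_square)
  obtain v where v: "lipc 1 v" "\<And>e N. e > 0 \<Longrightarrow> \<exists>n\<ge>N. \<forall>x\<in>carrier G. \<bar>w n x - v x\<bar> < e"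
    using lipc_cluster_function[of 1 w r] w_lipc w_bound by blast
  have lv: "lip v" using v(1) by (rule lipc_lip)
  have approx: "\<exists>n. (\<forall>x\<in>carrier G. \<bar>w n x - v x\<bar> \<le> e) \<and>
      (\<forall>x\<in>carrier G. \<bar>kop r (kop r (w n)) x - \<mu> * w n x\<bar> \<le> e)" if e: "e > 0" for e
  proof -
    obtain N where N: "\<And>n. n \<ge> N \<Longrightarrow> \<bar>r * sqrt (q (Suc n) * q n - 2 * \<mu> * q n + \<mu>\<^sup>2)\<bar> < e"
      using LIMSEQ_D[OF lim0 e] by auto
    obtain n where n: "n \<ge> N" "\<forall>x\<in>carrier G. \<bar>w n x - v x\<bar> < e" using v(2)[OF e] by blast
    have "\<bar>kop r (kop r (w n)) x - \<mu> * w n x\<bar> \<le> e" if "x \<in> carrier G" for x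
      using w_eig[OF that, of n] N[OF n(1)] by linarith
    then show ?thesis using n(2) by (intro exI[of _ n]) (auto intro: less_imp_le)
  qed
  have "kop r (kop r v) x = \<mu> * v x" if x: "x \<in> carrier G" for x
  proof -
    have "\<bar>kop r (kop r v) x - \<mu> * v x\<bar> \<le> e" if e: "e > 0" for e
    proof -
      \<comment> \<open>Errors of size \<open>d\<close> enter through two applications of the
        operator, the approximate eigenvalue equation, and the term with
        \<open>\<mu>\<close>.\<close>
      define c where "c = r * r + 1 + \<mu>"
      have c: "c > 0" unfolding c_def using \<mu>_pos by (simp add: add_nonneg_pos)
      define d where "d = e / c"
      have d: "d > 0" unfolding d_def using c e by simp
      obtain n where n: "\<forall>x\<in>carrier G. \<bar>w n x - v x\<bar> \<le> d"
        "\<forall>x\<in>carrier G. \<bar>kop r (kop r (w n)) x - \<mu> * w n x\<bar> \<le> d" using approx[OF d] by blast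
      have 1: "\<bar>kop r (w n) y - kop r v y\<bar> \<le> r * d" if "y \<in> carrier G" for y
        unfolding kop_diff[OF lw lv that, symmetric] using n(1) that
        by (intro kop_abs_le[OF r] lip_diff lw lv) auto
      have 2: "\<bar>kop r (kop r (w n)) x - kop r (kop r v) x\<bar> \<le> r * (r * d)"
        unfolding kop_diff[OF lip_kop[OF lw] lip_kop[OF lv] x, symmetric] using 1 x
        by (intro kop_abs_le[OF r] lip_diff lip_kop lw lv) auto
      have "\<bar>\<mu> * (w n x - v x)\<bar> \<le> \<mu> * d"
        unfolding abs_mult using n(1) x \<mu>_pos by (intro mult_mono) auto
      then have 3: "\<bar>\<mu> * w n x - \<mu> * v x\<bar> \<le> \<mu> * d" by (simp add: right_diff_distrib)
      have "\<bar>kop r (kop r v) x - \<mu> * v x\<bar> \<le> r * (r * d) + d + \<mu> * d"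
        using 2 3 bspec[OF n(2) x] by linarith
      also have "\<dots> = c * d" unfolding c_def by (simp add: algebra_simps)
      also have "\<dots> = e" unfolding d_def using c by simp
      finally show ?thesis .
    qed
    then show ?thesis by (meson abs_le_zero_iff dense_ge eq_iff_diff_eq_0)
  qed
  moreover have "mean v = 0"
  proof -
    have "\<bar>mean v\<bar> \<le> e" if e: "e > 0" for e
    proof -
      obtain n where n: "\<forall>x\<in>carrier G. \<bar>w n x - v x\<bar> \<le> e" using approx[OF e] by blast
      have "\<bar>mean (\<lambda>x. w n x - v x)\<bar> \<le> e" using n by (intro mean_abs_le lip_diff lw lv) auto
      then show ?thesis using mean_diff[OF lw lv, of n] w_mean[of n] by simp
    qed
    then show ?thesis by (meson abs_le_zero_iff dense_ge)
  qed
  moreover have "\<exists>x\<in>carrier G. v x \<noteq> 0"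
  proof (rule ccontr)
    assume "\<not> ?thesis"
    then have v0: "v x = 0" if "x \<in> carrier G" for x using that by blast
    \<comment> \<open>The squared norms \<open>q n\<close> never fall below \<open>q 0\<close>, so
      the normalised iterates cannot come this close to 0.\<close>
    define e where "e = sqrt (q 0 / 2)"
    have e: "e > 0" unfolding e_def using q_pos[of 0] by simp
    obtain n where n: "\<forall>x\<in>carrier G. \<bar>w n x - v x\<bar> \<le> e" using approx[OF e] by blast
    have "w n x * w n x \<le> e * e" if "x \<in> carrier G" for x
    proof -
      have "\<bar>w n x\<bar> * \<bar>w n x\<bar> \<le> e * e" using n that v0[OF that] e by (intro mult_mono) auto
      then show ?thesis by simp
    qed
    then have "ip (w n) (w n) \<le> e * e" by (intro mean_le lip_mult lw) auto
    also have "\<dots> = q 0 / 2" unfolding e_def using q_pos[of 0] by simp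
    finally have "q n \<le> q 0 / 2" unfolding w_ip .
    moreover have "q 0 \<le> q n" using \<open>incseq q\<close> by (simp add: incseqD)
    ultimately show False using q_pos[of 0] by linarith
  qed
  ultimately show thesis using that[OF lv \<mu>_pos] by blast
qed

definition eigenfunctions :: "real \<Rightarrow> real \<Rightarrow> ('a \<Rightarrow> real) set" where
  "eigenfunctions r \<mu> = {v. lip v \<and> (\<forall>x\<in>carrier G. kop r (kop r v) x = \<mu> * v x)}"

lemma eigenfunctions_left:
  assumes "v \<in> eigenfunctions r \<mu>" "a \<in> carrier G"
  shows "(\<lambda>x. v (a \<otimes> x)) \<in> eigenfunctions r \<mu>"
proof -
  have v: "lip v" "\<forall>x\<in>carrier G. kop r (kop r v) x = \<mu> * v x"
    using assms unfolding eigenfunctions_def by auto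
  have "kop r (kop r (\<lambda>x. v (a \<otimes> x))) x = \<mu> * v (a \<otimes> x)" if x: "x \<in> carrier G" for x
  proof -
    have "kop r (kop r (\<lambda>x. v (a \<otimes> x))) x = kop r (\<lambda>y. kop r v (a \<otimes> y)) x"
      using v assms(2) x by (intro kop_cong lip_kop lip_left) (auto simp: kop_left)
    also have "\<dots> = \<mu> * v (a \<otimes> x)"
      using kop_left[OF lip_kop[OF v(1)] assms(2) x] v assms(2) x by simp
    finally show ?thesis .
  qed
  then show ?thesis using lip_left[OF v(1) assms(2)] unfolding eigenfunctions_def by auto
qed

lemma eigenfunctions_diff:
  assumes "v \<in> eigenfunctions r \<mu>" "w \<in> eigenfunctions r \<mu>"
  shows "(\<lambda>x. v x - w x) \<in> eigenfunctions r \<mu>"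
proof -
  have v: "lip v" "\<forall>x\<in>carrier G. kop r (kop r v) x = \<mu> * v x"
    and w: "lip w" "\<forall>x\<in>carrier G. kop r (kop r w) x = \<mu> * w x"
    using assms unfolding eigenfunctions_def by auto
  have "kop r (kop r (\<lambda>x. v x - w x)) x = \<mu> * (v x - w x)" if x: "x \<in> carrier G" for x
  proof -
    have "kop r (kop r (\<lambda>x. v x - w x)) x = kop r (\<lambda>y. kop r v y - kop r w y) x"
      using v w x by (intro kop_cong) (auto simp: kop_diff)
    also have "\<dots> = kop r (kop r v) x - kop r (kop r w) x"
      using v w x by (intro kop_diff) auto
    finally show ?thesis using v(2) w(2) x by (simp add: right_diff_distrib)
  qed
  then show ?thesis using v(1) w(1) unfolding eigenfunctions_def by auto
qed

text \<open>Write \<open>v\<close> as \<open>1 / \<mu>\<close> times the twice applied operator and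
  use its smoothing. The factor of \<open>B\<close> is the same for every eigenfunction and every
  \<open>x\<close>.\<close>

lemma eigenfunctions_near:
  assumes "r > 0" "\<mu> > 0" "v \<in> eigenfunctions r \<mu>" "\<And>x. x \<in> carrier G \<Longrightarrow> \<bar>v x\<bar> \<le> B"
    and "b \<in> carrier G" "x \<in> carrier G"
  shows "\<bar>v (b \<otimes> x) - v x\<bar> \<le> (r / \<mu> * D \<one> b) * B"
proof -
  have v: "lip v" "\<forall>x\<in>carrier G. kop r (kop r v) x = \<mu> * v x"
    using assms(3) unfolding eigenfunctions_def by auto
  have "lipc (r * B) (kop r (kop r v))"
    using kop_abs_le[OF assms(1) v(1) assms(4)] by (intro lipc_kop lip_kop v(1)) auto
  then have "\<bar>\<mu> * v (b \<otimes> x) - \<mu> * v x\<bar> \<le> r * B * D (b \<otimes> x) x"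
    using lipcD[of "r * B" "kop r (kop r v)" "b \<otimes> x" x] v(2) assms(5,6) by simp
  also have "D (b \<otimes> x) x = D \<one> b"
    using D_right[of x b \<one>] D_sym[of b \<one>] assms(5,6) by simp
  finally have "\<mu> * \<bar>v (b \<otimes> x) - v x\<bar> \<le> r * B * D \<one> b"
    using assms(2) by (simp flip: right_diff_distrib add: abs_mult)
  then show ?thesis using assms(2) by (simp add: field_simps)
qed

section \<open>Chains of subgroups acting on eigenfunctions\<close>

text \<open>With \<open>u x = v (g \<otimes> x) - v x\<close>, the sum of \<open>u\<close> over the first \<open>N\<close> powers of \<open>g\<close> telescopes
  and so stays bounded, while each summand differs from \<open>u x\<close> by at most half of a bound of \<open>u\<close>;
  hence any bound of \<open>u\<close> can be halved.\<close>
lemma small_subgroup_acts_trivially: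
  assumes H: "subgroup H G"
    and small: "\<And>u B g x. u \<in> eigenfunctions r \<mu> \<Longrightarrow> (\<And>x. x \<in> carrier G \<Longrightarrow> \<bar>u x\<bar> \<le> B) \<Longrightarrow> g \<in> H \<Longrightarrow>
      x \<in> carrier G \<Longrightarrow> \<bar>u (g \<otimes> x) - u x\<bar> \<le> B / 2"
    and v: "v \<in> eigenfunctions r \<mu>" and g: "g \<in> H" and x: "x \<in> carrier G"
  shows "v (g \<otimes> x) = v x"
proof -
  have gc: "g \<in> carrier G" using H g by (rule subgroup.mem_carrier)
  define u where "u = (\<lambda>x. v (g \<otimes> x) - v x)"
  have u: "u \<in> eigenfunctions r \<mu>"
    unfolding u_def by (intro eigenfunctions_diff eigenfunctions_left v gc)
  have "lip v" using v unfolding eigenfunctions_def by auto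
  then obtain C where C: "C > 0" "\<And>x. x \<in> carrier G \<Longrightarrow> \<bar>v x\<bar> \<le> C"
    using lip_bounded by blast
  have pow: "g [^] n \<in> H" for n :: nat
    using subgroup.m_closed[OF H] subgroup.one_closed[OF H] g by (induction n) auto
  have tele: "(\<Sum>k<n. u (g [^] k \<otimes> x)) = v (g [^] n \<otimes> x) - v x" if x: "x \<in> carrier G" for n :: nat and x
  proof (induction n)
    case (Suc n)
    have "g \<otimes> (g [^] n \<otimes> x) = g [^] Suc n \<otimes> x"
      using gc x by (simp add: m_assoc[symmetric] nat_pow_comm[of g 1 n, simplified])
    then show ?case using Suc unfolding u_def by simp
  qed (use x in simp)
  have halve: "\<bar>u x\<bar> \<le> B / 2" if B: "\<And>x. x \<in> carrier G \<Longrightarrow> \<bar>u x\<bar> \<le> B" and x: "x \<in> carrier G" for B x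
  proof -
    \<comment> \<open>The telescoped sum is at most \<open>2 * C\<close> in size and differs from
      \<open>n * u x\<close> by at most \<open>n * (B / 2)\<close>. For large \<open>n\<close> this
      forces the halved bound.\<close>
    have *: "real n * (\<bar>u x\<bar> - B / 2) \<le> 2 * C" for n :: nat
    proof -
      have "(\<Sum>k<n. u (g [^] k \<otimes> x) - u x) = (v (g [^] n \<otimes> x) - v x) - n * u x"
        using tele[OF x] by (simp add: sum_subtractf)
      moreover have "\<bar>\<Sum>k<n. u (g [^] k \<otimes> x) - u x\<bar> \<le> (\<Sum>k<n. B / 2)"
        using small[OF u B pow x] by (intro sum_abs[THEN order_trans] sum_mono) auto
      moreover have "\<bar>v (g [^] n \<otimes> x)\<bar> \<le> C" "\<bar>v x\<bar> \<le> C" using C gc x by auto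
      ultimately have "\<bar>n * u x\<bar> \<le> 2 * C + (\<Sum>k<n. B / 2)" by linarith
      then have "\<bar>n * u x\<bar> \<le> 2 * C + n * (B / 2)" by simp
      then show ?thesis by (simp add: abs_mult algebra_simps)
    qed
    show ?thesis
    proof (rule ccontr)
      assume "\<not> ?thesis"
      then have "\<bar>u x\<bar> - B / 2 > 0" by simp
      then obtain n :: nat where "2 * C < n * (\<bar>u x\<bar> - B / 2)" using reals_Archimedean3 by blast
      then show False using *[of n] by linarith
    qed
  qed
  have "\<forall>x\<in>carrier G. \<bar>u x\<bar> \<le> 2 * C / 2 ^ n" for n :: nat
  proof (induction n)
    case 0
    have "\<bar>u x\<bar> \<le> 2 * C" if "x \<in> carrier G" for x
      using C(2)[of x] C(2)[of "g \<otimes> x"] that gc unfolding u_def by (simp add: abs_le_iff)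
    then show ?case by simp
  next
    case (Suc n)
    then show ?case using halve[of "2 * C / 2 ^ n"] by (simp add: mult.commute)
  qed
  then have "\<bar>u x\<bar> \<le> 2 * C * (1 / 2) ^ n" for n :: nat
    using x by (simp add: power_divide)
  moreover have "(\<lambda>n. 2 * C * (1 / 2) ^ n) \<longlonglongrightarrow> 2 * C * 0"
    by (intro tendsto_mult_left LIMSEQ_power_zero) simp
  ultimately have "\<bar>u x\<bar> \<le> 2 * C * 0"
    by (intro LIMSEQ_le_const) auto
  then show ?thesis unfolding u_def by simp
qed

text \<open>A witness form of the radius bound: every element of the next subgroup can be moved
  within \<open>\<delta>\<close> of the identity by an element of the current one.\<close>

definition fine_chain :: "real \<Rightarrow> nat \<Rightarrow> (nat \<Rightarrow> 'a set) \<Rightarrow> bool" where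
  "fine_chain \<delta> m H \<longleftrightarrow> H 0 = {\<one>} \<and> (\<forall>i\<le>m. subgroup (H i) G) \<and>
     (\<forall>i<m. \<forall>g\<in>H (Suc i). \<exists>h\<in>H i. D \<one> (g \<otimes> h) \<le> \<delta>)"

text \<open>If \<open>H i\<close> acts trivially, then \<open>g\<close> moves eigenfunctions exactly
  as \<open>g \<otimes> h\<close> does. The fineness \<open>\<mu> / (2 * r)\<close> makes the factor
  in \<open>eigenfunctions_near\<close> equal to \<open>1 / 2\<close>, as
  \<open>small_subgroup_acts_trivially\<close> requires.\<close>

lemma fine_chain_acts_trivially:
  assumes "r > 0" "\<mu> > 0" and chain: "fine_chain (\<mu> / (2 * r)) m H"
  shows "i \<le> m \<Longrightarrow> v \<in> eigenfunctions r \<mu> \<Longrightarrow> g \<in> H i \<Longrightarrow> x \<in> carrier G \<Longrightarrow> v (g \<otimes> x) = v x"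
proof (induction i arbitrary: v g x)
  case 0
  then show ?case using chain unfolding fine_chain_def by simp
next
  case (Suc i)
  have H: "subgroup (H (Suc i)) G" "subgroup (H i) G"
    using Suc.prems(1) chain unfolding fine_chain_def by auto
  show ?case
  proof (rule small_subgroup_acts_trivially[OF H(1) _ Suc.prems(2,3,4)])
    fix u B g x assume u: "u \<in> eigenfunctions r \<mu>" and B: "\<And>x. x \<in> carrier G \<Longrightarrow> \<bar>u x\<bar> \<le> B"
      and g: "g \<in> H (Suc i)" and x: "x \<in> carrier G"
    obtain h where h: "h \<in> H i" "D \<one> (g \<otimes> h) \<le> \<mu> / (2 * r)"
      using g Suc.prems(1) chain unfolding fine_chain_def by (meson Suc_le_eq)
    have c: "g \<in> carrier G" "h \<in> carrier G" using g h H subgroup.mem_carrier by metis+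
    have B0: "B \<ge> 0" using B[OF x] by linarith
    \<comment> \<open>The induction hypothesis is applied to the translate of \<open>u\<close> by
      \<open>g \<otimes> h\<close>, itself an eigenfunction, and to \<open>inv h\<close>.\<close>
    have "u (g \<otimes> x) = u ((g \<otimes> h) \<otimes> (inv h \<otimes> x))"
      using c x by (simp add: m_assoc) (simp add: m_assoc[symmetric])
    also have "\<dots> = u ((g \<otimes> h) \<otimes> x)"
      using Suc.IH[of "\<lambda>y. u ((g \<otimes> h) \<otimes> y)" "inv h" x] Suc.prems(1) x c
        eigenfunctions_left[OF u] subgroup.m_inv_closed[OF H(2) h(1)] by simp
    finally have "\<bar>u (g \<otimes> x) - u x\<bar> \<le> (r / \<mu> * D \<one> (g \<otimes> h)) * B"
      using eigenfunctions_near[OF assms(1,2) u B _ x, of "g \<otimes> h"] c by simp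
    also have "\<dots> \<le> (r / \<mu> * (\<mu> / (2 * r))) * B"
      using h(2) assms B0 by (intro mult_right_mono mult_left_mono) auto
    also have "\<dots> = B / 2" using assms by simp
    finally show "\<bar>u (g \<otimes> x) - u x\<bar> \<le> B / 2" .
  qed
qed

lemma trivial_of_fine_chains:
  assumes "\<And>\<delta> p e. \<delta> > 0 \<Longrightarrow> p \<in> carrier G \<Longrightarrow> e > 0 \<Longrightarrow>
    \<exists>m H. fine_chain \<delta> m H \<and> (\<exists>g\<in>H m. D g p < e)"
  shows "carrier G = {\<one>}"
proof (rule ccontr)
  assume "carrier G \<noteq> {\<one>}"
  then obtain z where z: "z \<in> carrier G" "z \<noteq> \<one>" using one_closed by blast
  \<comment> \<open>The centred distance to the identity is nonconstant as soon as \<open>z\<close>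
    exists; iteration at mean zero will exclude constant eigenfunctions.\<close>
  define f where "f = (\<lambda>x. D \<one> x - mean (D \<one>))"
  have "lipc 1 (D \<one>)"
    unfolding lipc_def
  proof (intro ballI)
    fix x y assume "x \<in> carrier G" "y \<in> carrier G"
    then show "\<bar>D \<one> x - D \<one> y\<bar> \<le> 1 * D x y"
      using D_triangle[of \<one> x y] D_triangle[of \<one> y x] D_sym[of x y] by simp
  qed
  then have lD: "lip (D \<one>)" by (rule lipc_lip)
  have lf: "lip f" unfolding f_def by (rule lip_diff[OF lD lip_const])
  have mf: "mean f = 0" unfolding f_def using mean_diff[OF lD lip_const] by (simp add: mean_const)
  have "f \<one> \<noteq> f z" unfolding f_def using D_pos[OF one_closed z(1)] D_refl[of \<one>] z by auto
  then obtain p where p: "p \<in> carrier G" "f p \<noteq> 0" using z by (metis one_closed)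
  define s where "s = sgn (f p)"
  have sp: "s * f p = \<bar>f p\<bar>" unfolding s_def by (simp add: abs_sgn mult.commute)
  define F where "F = (\<lambda>x. s * f x)"
  have lF: "lip F" unfolding F_def using lf by blast
  have mF: "mean F = 0" unfolding F_def using mean_cmult[OF lf] mf by simp
  have Fp: "F p > 0" unfolding F_def sp using p by simp
  obtain L where L: "L > 0" "lipc L F" by (rule lipE[OF lF])
  \<comment> \<open>Within this distance of \<open>p\<close> the Lipschitz bound keeps
    \<open>F\<close> nonnegative, so the kernel at \<open>p\<close> sees no cancellation and the
    iteration starts with a nonzero image.\<close>
  define r where "r = F p / L"
  have r: "r > 0" unfolding r_def using Fp L by simp
  have kFp: "kop r F p > 0"
    unfolding kop_def
  proof (rule mean_pos[of _ p])
    show "lip (\<lambda>y. kern r p y * F y)" by (rule lip_kern_mult[OF p(1) lF])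
    show "0 \<le> kern r p y * F y" if y: "y \<in> carrier G" for y
    proof (cases "D p y < r")
      case True
      then have "L * D p y < F p" using L unfolding r_def by (simp add: field_simps)
      then have "0 \<le> F y" using lipcD[OF L(2) p(1) y] by linarith
      then show ?thesis using kern_nonneg by simp
    qed (simp add: kern_def)
    show "0 < kern r p p * F p" unfolding kern_def using D_refl[OF p(1)] r Fp by simp
  qed (rule p)
  obtain w \<mu> where w: "lip w" "\<mu> > 0" "\<And>x. x \<in> carrier G \<Longrightarrow> kop r (kop r w) x = \<mu> * w x"
    "mean w = 0" "\<exists>x\<in>carrier G. w x \<noteq> 0"
    by (rule kop_eigenvector[OF r lF p(1) less_imp_neq[OF kFp, symmetric] mF]) blast
  obtain L where L: "L > 0" "lipc L w" by (rule lipE[OF w(1)])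
  \<comment> \<open>Points of the subgroups \<open>H m\<close> come arbitrarily close to
    \<open>q\<close>, and \<open>w\<close> takes at each of them its value at the identity.\<close>
  have wc: "w q = w \<one>" if q: "q \<in> carrier G" for q
  proof -
    have "\<bar>w q - w \<one>\<bar> \<le> e" if e: "e > 0" for e
    proof -
      obtain m H g where m: "fine_chain (\<mu> / (2 * r)) m H" "g \<in> H m" "D g q < e / L"
        using assms[OF divide_pos_pos[OF w(2) mult_pos_pos[OF zero_less_numeral r]] q divide_pos_pos[OF e L(1)]]
        by blast
      have gc: "g \<in> carrier G"
        using m(1,2) subgroup.mem_carrier[of "H m" G g] unfolding fine_chain_def by simp
      have "w g = w \<one>"
        using fine_chain_acts_trivially[OF r w(2) m(1) order_refl _ m(2) one_closed, of w] w gc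
        unfolding eigenfunctions_def by simp
      moreover have "\<bar>w g - w q\<bar> \<le> L * D g q" using lipcD[OF L(2) gc q] .
      moreover have "L * D g q < e" using m(3) L(1) by (simp add: field_simps)
      ultimately show ?thesis by linarith
    qed
    then show ?thesis by (meson abs_le_zero_iff dense_ge eq_iff_diff_eq_0)
  qed
  have "mean w = mean (\<lambda>_. w \<one>)"
    by (rule mean_cong[OF w(1) lip_const wc])
  then have "w \<one> = 0" using w(4) by (simp add: mean_const)
  then show False using w(5) wc by metis
qed

end

section \<open>Right-invariant metrics and compactness\<close>

primrec set_pow :: "('a, 'b) monoid_scheme \<Rightarrow> 'a set \<Rightarrow> nat \<Rightarrow> 'a set" where
  "set_pow G B 0 = {\<one>\<^bsub>G\<^esub>}"
| "set_pow G B (Suc k) = (\<lambda>(x, y). x \<otimes>\<^bsub>G\<^esub> y) ` (B \<times> set_pow G B k)"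

locale right_invariant_group = group G + Metric_space "carrier G" d for G (structure) and d +
  assumes top_group: "topological_group G mtopology"
    and right_inv: "right_invariant G d"
begin

lemma d_right: "g \<in> carrier G \<Longrightarrow> x \<in> carrier G \<Longrightarrow> y \<in> carrier G \<Longrightarrow> d (x \<otimes> g) (y \<otimes> g) = d x y"
  using right_inv unfolding right_invariant_def by blast

lemma d_one_mult_le:
  assumes "x \<in> carrier G" "y \<in> carrier G"
  shows "d \<one> (x \<otimes> y) \<le> d \<one> x + d \<one> y"
  using triangle[of \<one> y "x \<otimes> y"] d_right[of y \<one> x] assms by simp

lemma continuous_mult: "continuous_map (prod_topology mtopology mtopology) mtopology (\<lambda>(x, y). x \<otimes> y)"
  using top_group unfolding topological_group_def by blast

lemma compactin_set_pow:
  assumes "compactin mtopology B"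
  shows "compactin mtopology (set_pow G B k)"
proof (induction k)
  case (Suc k)
  have "compactin (prod_topology mtopology mtopology) (B \<times> set_pow G B k)"
    using Suc assms by (simp add: compactin_Times)
  then show ?case
    using image_compactin[OF _ continuous_mult] by simp
qed simp

lemma set_pow_carrier: "B \<subseteq> carrier G \<Longrightarrow> set_pow G B k \<subseteq> carrier G"
  by (induction k) auto

lemma set_pow_mono:
  assumes "B \<subseteq> carrier G" "\<one> \<in> B" "k \<le> l"
  shows "set_pow G B k \<subseteq> set_pow G B l"
  using assms(3)
proof (induction l rule: dec_induct)
  case (step l)
  have "x \<in> set_pow G B (Suc l)" if "x \<in> set_pow G B l" for x
    using that set_pow_carrier[OF assms(1), of l] assms(2)
    by (auto intro!: image_eqI[of _ _ "(\<one>, x)"])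
  with step show ?case by blast
qed simp

text \<open>The factors of length at most \<open>\<beta> i\<close> supplied by the chain are collected into blocks of length
  at most \<open>r\<close>; a new block is opened only when the current one is longer than \<open>r / 2\<close>, so the
  number of blocks is bounded in terms of the sum of the \<open>\<beta> i\<close>.\<close>
lemma chain_blocks:
  assumes r: "r > 0" and B: "\<And>x. x \<in> carrier G \<Longrightarrow> d \<one> x \<le> r \<Longrightarrow> x \<in> B"
    and \<beta>: "\<And>i. i < m \<Longrightarrow> \<beta> i \<le> r / 2" and H0: "H 0 = {\<one>}"
    and step: "\<And>i g. i < m \<Longrightarrow> g \<in> H (Suc i) \<Longrightarrow>
      \<exists>b h. b \<in> carrier G \<and> h \<in> H i \<and> g = b \<otimes> h \<and> d \<one> b \<le> \<beta> i"
    and Bc: "B \<subseteq> carrier G"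
  shows "i \<le> m \<Longrightarrow> g \<in> H i \<Longrightarrow> \<exists>k c p. c \<in> carrier G \<and> p \<in> set_pow G B k \<and> g = c \<otimes> p \<and>
    d \<one> c \<le> r \<and> k * (r / 2) + d \<one> c \<le> (\<Sum>j<i. \<beta> j)"
proof (induction i arbitrary: g)
  case 0
  then show ?case using H0 r by (intro exI[of _ 0] exI[of _ \<one>]) auto
next
  case (Suc i)
  obtain b h where b: "b \<in> carrier G" "h \<in> H i" "g = b \<otimes> h" "d \<one> b \<le> \<beta> i"
    using step[of i g] Suc.prems by auto
  obtain k c p where c: "c \<in> carrier G" "p \<in> set_pow G B k" "h = c \<otimes> p" "d \<one> c \<le> r"
    "k * (r / 2) + d \<one> c \<le> (\<Sum>j<i. \<beta> j)"
    using Suc.IH[of h] Suc.prems(1) b(2) by auto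
  have p: "p \<in> carrier G" using set_pow_carrier[OF Bc] c(2) by blast
  have \<beta>i: "\<beta> i \<le> r / 2" using \<beta>[of i] Suc.prems(1) by simp
  show ?case
  proof (cases "d \<one> c \<le> r / 2")
    case True
    have "g = (b \<otimes> c) \<otimes> p" using b c p by (simp add: m_assoc)
    moreover have "d \<one> (b \<otimes> c) \<le> d \<one> b + d \<one> c" using d_one_mult_le b c by blast
    ultimately show ?thesis
      using b c True \<beta>i by (intro exI[of _ k] exI[of _ "b \<otimes> c"] exI[of _ p]) auto
  next
    case False
    \<comment> \<open>The block \<open>c\<close> is closed. Its length above \<open>r / 2\<close>
      pays for the new summand \<open>r / 2\<close>, and \<open>b\<close> opens the next
      block.\<close>
    have "c \<otimes> p \<in> set_pow G B (Suc k)"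
      using B[OF c(1,4)] c(2) by auto
    moreover have "real (Suc k) * (r / 2) + d \<one> b \<le> (\<Sum>j<Suc i. \<beta> j)"
    proof -
      have "real (Suc k) * (r / 2) = r / 2 + k * (r / 2)"
        by (simp only: of_nat_Suc distrib_right mult_1)
      then show ?thesis using False b(4) c(5) unfolding sum.lessThan_Suc by linarith
    qed
    moreover have "d \<one> b \<le> r" using b(4) \<beta>i r by linarith
    ultimately show ?thesis
      using b c(3) by (intro exI[of _ "Suc k"] exI[of _ b] exI[of _ "c \<otimes> p"]) simp
  qed
qed

text \<open>The slack \<open>\<eta>\<close> is there because an infimum is only approached.
  Boundedness of the compact \<open>H\<close> makes the real supremum a genuine upper bound.\<close>

lemma quotient_radius_witness:
  assumes H: "compactin mtopology H" and H': "H' \<subseteq> carrier G" "H' \<noteq> {}" and g: "g \<in> H" and \<eta>: "\<eta> > 0"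
  obtains h where "h \<in> H'" "d \<one> (g \<otimes> h) < quotient_radius G d H H' + \<eta>"
proof -
  define \<phi> where "\<phi> g = (INF h\<in>H'. d \<one> (g \<otimes> h))" for g
  have bel: "bdd_below ((\<lambda>h. d \<one> (g \<otimes> h)) ` H')" for g by (rule bdd_belowI2[of _ 0]) simp
  have Hc: "H \<subseteq> carrier G" using compactin_subset_topspace[OF H] by simp
  obtain h0 where h0: "h0 \<in> H'" "h0 \<in> carrier G" using H' by blast
  have "mbounded (insert \<one> H)"
    using compactin_imp_mbounded[OF H] by (simp add: mbounded_insert)
  then obtain C where C: "\<forall>x\<in>insert \<one> H. \<forall>y\<in>insert \<one> H. d x y \<le> C"
    unfolding mbounded_alt by blast
  have "\<phi> x \<le> C + d \<one> h0" if x: "x \<in> H" for x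
  proof -
    have "\<phi> x \<le> d \<one> (x \<otimes> h0)" unfolding \<phi>_def by (rule cINF_lower[OF bel h0(1)])
    also have "\<dots> \<le> d \<one> x + d \<one> h0" using x Hc h0 by (intro d_one_mult_le) auto
    also have "d \<one> x \<le> C" using C x by blast
    finally show ?thesis by simp
  qed
  then have "bdd_above (\<phi> ` H)" by (rule bdd_aboveI2)
  then have "\<phi> g \<le> quotient_radius G d H H'"
    unfolding quotient_radius_def \<phi>_def[symmetric] by (rule cSUP_upper[OF g])
  then have "\<phi> g < quotient_radius G d H H' + \<eta>" using \<eta> by simp
  then obtain h where "h \<in> H'" "d \<one> (g \<otimes> h) < quotient_radius G d H H' + \<eta>"
    unfolding \<phi>_def cINF_less_iff[OF H'(2) bel] by blast
  then show thesis by (rule that)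
qed

text \<open>Left translations need not be isometries of \<open>d\<close>; continuity of the
  multiplication gives a \<open>\<delta>\<close> that depends on \<open>a\<close>.\<close>

lemma continuous_translation:
  assumes a: "a \<in> carrier G" and e: "e > 0"
  obtains \<delta> where "\<delta> > 0" "\<And>b. b \<in> carrier G \<Longrightarrow> d \<one> b < \<delta> \<Longrightarrow> d a (a \<otimes> b) < e"
proof -
  have "continuous_map mtopology mtopology ((\<lambda>(x, y). x \<otimes> y) \<circ> (\<lambda>b. (a, b)))"
    using a by (intro continuous_map_compose[OF _ continuous_mult] continuous_map_pairedI) auto
  then have "continuous_map mtopology mtopology (\<lambda>b. a \<otimes> b)" by (simp add: o_def)
  then have "openin mtopology {b \<in> topspace mtopology. a \<otimes> b \<in> mball a e}"
    by (rule openin_continuous_map_preimage) simp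
  moreover have "\<one> \<in> {b \<in> topspace mtopology. a \<otimes> b \<in> mball a e}" using a e by simp
  ultimately obtain \<delta> where "\<delta> > 0" "mball \<one> \<delta> \<subseteq> {b \<in> topspace mtopology. a \<otimes> b \<in> mball a e}"
    unfolding openin_mtopology by blast
  then show thesis by (intro that[of \<delta>]) (auto simp: subset_iff)
qed

section \<open>The bi-invariant supremum metric of a compact group\<close>

definition dsup :: "'a \<Rightarrow> 'a \<Rightarrow> real" where
  "dsup x y = (SUP g\<in>carrier G. d (g \<otimes> x) (g \<otimes> y))"

context
  assumes compact: "compact_space mtopology"
begin

lemma bdd_above_translates:
  assumes "x \<in> carrier G" "y \<in> carrier G"
  shows "bdd_above ((\<lambda>g. d (g \<otimes> x) (g \<otimes> y)) ` carrier G)"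
proof -
  have "mbounded (carrier G)"
    using compactin_imp_mbounded compact unfolding compact_space_def by simp
  then obtain C where "\<forall>x\<in>carrier G. \<forall>y\<in>carrier G. d x y \<le> C"
    unfolding mbounded_alt by blast
  then show ?thesis using assms by (intro bdd_aboveI2[of _ _ C]) auto
qed

lemma d_le_dsup: "g \<in> carrier G \<Longrightarrow> x \<in> carrier G \<Longrightarrow> y \<in> carrier G \<Longrightarrow> d (g \<otimes> x) (g \<otimes> y) \<le> dsup x y"
  unfolding dsup_def by (rule cSUP_upper[OF _ bdd_above_translates])

lemma dsup_least: "(\<And>g. g \<in> carrier G \<Longrightarrow> d (g \<otimes> x) (g \<otimes> y) \<le> c) \<Longrightarrow> dsup x y \<le> c"
  unfolding dsup_def by (rule cSUP_least) auto

text \<open>Right invariance reduces the claim to bounding \<open>d g (g \<otimes> b)\<close> for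
  all \<open>g\<close> at once. Replacing \<open>g\<close> by a point \<open>a\<close> of a finite
  net changes each end by \<open>d a g\<close>, again by right invariance, so finitely many moduli
  suffice.\<close>

lemma dsup_uniform:
  assumes e: "e > 0"
  obtains \<delta> where "\<delta> > 0" "\<And>x y. x \<in> carrier G \<Longrightarrow> y \<in> carrier G \<Longrightarrow> d x y < \<delta> \<Longrightarrow> dsup x y \<le> e"
proof -
  have "mtotally_bounded (carrier G)"
    using compactin_imp_mtotally_bounded compact unfolding compact_space_def by simp
  then obtain N where N: "finite N" "N \<subseteq> carrier G" "carrier G \<subseteq> (\<Union>x\<in>N. mball x (e / 3))"
    unfolding mtotally_bounded_def using e by (meson zero_less_divide_iff zero_less_numeral)
  have "\<forall>a\<in>N. \<exists>\<delta>>0. \<forall>b\<in>carrier G. d \<one> b < \<delta> \<longrightarrow> d a (a \<otimes> b) < e / 3"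
    using continuous_translation[of _ "e / 3"] N(2) e by (metis subsetD zero_less_divide_iff zero_less_numeral)
  then obtain \<delta> where \<delta>: "\<And>a. a \<in> N \<Longrightarrow> \<delta> a > 0"
    "\<And>a b. a \<in> N \<Longrightarrow> b \<in> carrier G \<Longrightarrow> d \<one> b < \<delta> a \<Longrightarrow> d a (a \<otimes> b) < e / 3" by metis
  define \<delta>0 where "\<delta>0 = Min (insert 1 (\<delta> ` N))"
  have \<delta>0: "\<delta>0 > 0" unfolding \<delta>0_def using N(1) \<delta>(1) by simp
  have "dsup x y \<le> e" if x: "x \<in> carrier G" and y: "y \<in> carrier G" and xy: "d x y < \<delta>0" for x y
  proof (rule dsup_least)
    fix g assume g: "g \<in> carrier G"
    define b where "b = y \<otimes> inv x"
    have b: "b \<in> carrier G" unfolding b_def using x y by simp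
    have "d \<one> b = d x y"
      unfolding b_def using d_right[of "inv x" x y] x y by simp
    then have db: "d \<one> b < \<delta>0" using xy by simp
    obtain a where a: "a \<in> N" "d a g < e / 3" using N(3) g by auto
    have ac: "a \<in> carrier G" using a N by auto
    have "\<delta>0 \<le> \<delta> a" unfolding \<delta>0_def using N(1) a by simp
    then have 1: "d a (a \<otimes> b) < e / 3" using \<delta>(2)[OF a(1) b] db by simp
    have "d (g \<otimes> x) (g \<otimes> y) = d ((g \<otimes> x) \<otimes> inv x) ((g \<otimes> y) \<otimes> inv x)"
      using d_right[of "inv x" "g \<otimes> x" "g \<otimes> y"] x y g by simp
    also have "\<dots> = d g (g \<otimes> b)"
      unfolding b_def using x y g by (simp add: m_assoc)
    also have "\<dots> \<le> d g a + (d a (a \<otimes> b) + d (a \<otimes> b) (g \<otimes> b))"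
      using triangle[of g a "g \<otimes> b"] triangle[of a "a \<otimes> b" "g \<otimes> b"] ac b g by simp
    also have "d (a \<otimes> b) (g \<otimes> b) = d a g" using d_right ac b g by simp
    also have "d g a + (d a (a \<otimes> b) + d a g) \<le> e" using 1 a(2) commute[of g a] by simp
    finally show "d (g \<otimes> x) (g \<otimes> y) \<le> e" .
  qed
  with \<delta>0 show thesis by (rule that)
qed

lemma dsup_left_le:
  "a \<in> carrier G \<Longrightarrow> x \<in> carrier G \<Longrightarrow> y \<in> carrier G \<Longrightarrow> dsup (a \<otimes> x) (a \<otimes> y) \<le> dsup x y"
  using d_le_dsup[OF m_closed, of _ a x y] by (intro dsup_least) (simp add: m_assoc)

lemma bi_invariant_dsup: "bi_invariant_group G dsup"
proof (intro bi_invariant_group.intro bi_invariant_group_axioms.intro is_group)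
  show "dsup x x = 0" if "x \<in> carrier G" for x
  proof (rule order_antisym)
    show "dsup x x \<le> 0" using that by (intro dsup_least) simp
    show "0 \<le> dsup x x" using d_le_dsup[OF one_closed that that] that by simp
  qed
  show "dsup x y > 0" if "x \<in> carrier G" "y \<in> carrier G" "x \<noteq> y" for x y
  proof -
    have "0 < d x y" using that nonneg[of x y] zero[of x y] by linarith
    also have "\<dots> \<le> dsup x y" using d_le_dsup[of \<one> x y] that by simp
    finally show ?thesis .
  qed
  show "dsup x y = dsup y x" for x y
    unfolding dsup_def by (simp add: commute)
  show "dsup x z \<le> dsup x y + dsup y z" if "x \<in> carrier G" "y \<in> carrier G" "z \<in> carrier G" for x y z
  proof (rule dsup_least)
    fix g assume g: "g \<in> carrier G"
    show "d (g \<otimes> x) (g \<otimes> z) \<le> dsup x y + dsup y z"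
      using triangle[of "g \<otimes> x" "g \<otimes> y" "g \<otimes> z"] d_le_dsup[of g x y] d_le_dsup[of g y z] g that by simp
  qed
  show "dsup (g \<otimes> x) (g \<otimes> y) = dsup x y" if "g \<in> carrier G" "x \<in> carrier G" "y \<in> carrier G" for g x y
  proof (rule order_antisym)
    have "inv g \<otimes> (g \<otimes> x) = x" "inv g \<otimes> (g \<otimes> y) = y"
      using that by (simp_all add: m_assoc[symmetric])
    then show "dsup x y \<le> dsup (g \<otimes> x) (g \<otimes> y)"
      using dsup_left_le[of "inv g" "g \<otimes> x" "g \<otimes> y"] that by simp
  qed (rule dsup_left_le[OF that])
  show "dsup (x \<otimes> g) (y \<otimes> g) = dsup x y" if "g \<in> carrier G" "x \<in> carrier G" "y \<in> carrier G" for g x y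
  proof -
    have "d (k \<otimes> (x \<otimes> g)) (k \<otimes> (y \<otimes> g)) = d (k \<otimes> x) (k \<otimes> y)" if "k \<in> carrier G" for k
      using d_right[of g "k \<otimes> x" "k \<otimes> y"] that \<open>g \<in> carrier G\<close> \<open>x \<in> carrier G\<close> \<open>y \<in> carrier G\<close>
      by (simp add: m_assoc)
    then have "(\<lambda>k. d (k \<otimes> (x \<otimes> g)) (k \<otimes> (y \<otimes> g))) ` carrier G = (\<lambda>k. d (k \<otimes> x) (k \<otimes> y)) ` carrier G"
      by (rule image_cong[OF refl])
    then show ?thesis unfolding dsup_def by (simp only:)
  qed
  show "\<exists>N. finite N \<and> N \<subseteq> carrier G \<and> (\<forall>x\<in>carrier G. \<exists>y\<in>N. dsup y x < e)" if e: "e > 0" for e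
  proof -
    obtain \<delta> where \<delta>: "\<delta> > 0"
      "\<And>x y. x \<in> carrier G \<Longrightarrow> y \<in> carrier G \<Longrightarrow> d x y < \<delta> \<Longrightarrow> dsup x y \<le> e / 2"
      using dsup_uniform[OF half_gt_zero[OF e]] by blast
    have tb: "mtotally_bounded (carrier G)"
      using compactin_imp_mtotally_bounded compact unfolding compact_space_def by simp
    obtain N where N: "finite N" "N \<subseteq> carrier G" "carrier G \<subseteq> (\<Union>x\<in>N. mball x \<delta>)"
      using tb[unfolded mtotally_bounded_def, rule_format, OF \<delta>(1)] by blast
    have "\<exists>y\<in>N. dsup y x < e" if x: "x \<in> carrier G" for x
    proof -
      obtain y where y: "y \<in> N" "d y x < \<delta>" using N(3) x by auto
      then have "dsup y x \<le> e / 2" using \<delta>(2) N(2) x by blast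
      then show ?thesis using y e by (intro bexI[of _ y]) auto
    qed
    with N show ?thesis by blast
  qed
qed

end

text \<open>For large \<open>n\<close> the block decomposition puts \<open>K n\<close> into a
  product of copies of the compact set \<open>B\<close>, their number depending only on
  \<open>C\<close> and \<open>r\<close>. Monotonicity covers small \<open>n\<close>, and the product
  set is closed, so it contains the closure of the union.\<close>

lemma compact_space_of_chains:
  assumes loc: "locally_compact_space mtopology"
    and dense: "mtopology closure_of (\<Union>n\<in>{1..}. K n) = carrier G"
    and mono: "\<And>n. n \<ge> 1 \<Longrightarrow> K n \<subseteq> K (Suc n)"
    and sub: "\<And>n i. n \<ge> 1 \<Longrightarrow> i \<le> M n \<Longrightarrow> subgroup (H n i) G"
    and H0: "\<And>n. n \<ge> 1 \<Longrightarrow> H n 0 = {\<one>}"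
    and HM: "\<And>n. n \<ge> 1 \<Longrightarrow> H n (M n) = K n"
    and wit: "\<And>n i g \<eta>. n \<ge> 1 \<Longrightarrow> i < M n \<Longrightarrow> g \<in> H n (Suc i) \<Longrightarrow> \<eta> > 0 \<Longrightarrow>
      \<exists>h\<in>H n i. d \<one> (g \<otimes> h) < \<rho> n (Suc i) + \<eta>"
    and bound: "\<And>n. n \<ge> 1 \<Longrightarrow> (\<Sum>i=1..M n. \<rho> n i) \<le> C"
    and small: "\<And>e. e > 0 \<Longrightarrow> \<exists>n0. \<forall>n\<ge>n0. \<forall>i\<in>{1..M n}. \<rho> n i < e"
  shows "compact_space mtopology"
proof -
  obtain U B where UB: "openin mtopology U" "compactin mtopology B" "\<one> \<in> U" "U \<subseteq> B"
    using loc one_closed unfolding locally_compact_space_def topspace_mtopology by blast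
  obtain R where R: "R > 0" "mball \<one> R \<subseteq> U"
    using UB(1,3) unfolding openin_mtopology by blast
  \<comment> \<open>Half the radius, so that the closed ball of radius \<open>r\<close> still lies
    in \<open>B\<close>.\<close>
  define r where "r = R / 2"
  have r: "r > 0" unfolding r_def using R by simp
  have Bc: "B \<subseteq> carrier G" using compactin_subset_topspace[OF UB(2)] by simp
  have B: "x \<in> B" if "x \<in> carrier G" "d \<one> x \<le> r" for x
  proof -
    have "x \<in> mball \<one> R" using that R unfolding r_def by simp
    then show ?thesis using R UB by blast
  qed
  have oneB: "\<one> \<in> B" using UB by blast
  \<comment> \<open>Solves \<open>k * (r / 2) \<le> C + 1\<close> for the number \<open>k\<close> of
    closed blocks; the current block accounts for the \<open>Suc\<close>.\<close>
  define l where "l = nat \<lceil>2 * (C + 1) / r\<rceil>"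
  obtain n0 where n0: "\<And>n i. n \<ge> n0 \<Longrightarrow> i \<in> {1..M n} \<Longrightarrow> \<rho> n i < r / 4"
    using small[OF divide_pos_pos[OF r zero_less_numeral]] by blast
  have large: "K n \<subseteq> set_pow G B (Suc l)" if n: "n \<ge> n0" "n \<ge> 1" for n
  proof
    fix g assume "g \<in> K n"
    then have g: "g \<in> H n (M n)" using HM n by simp
    \<comment> \<open>The first bound keeps every \<open>\<beta> i\<close> below
      \<open>r / 2\<close>; the second limits the total slack over all \<open>M n\<close> steps to
      1.\<close>
    define \<eta> where "\<eta> = min (r / 4) (1 / (M n + 1))"
    have \<eta>: "\<eta> > 0" unfolding \<eta>_def using r by simp
    define \<beta> where "\<beta> i = \<rho> n (Suc i) + \<eta>" for i
    have \<beta>: "\<beta> i \<le> r / 2" if "i < M n" for i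
      using n0[OF n(1), of "Suc i"] that unfolding \<beta>_def \<eta>_def by auto
    have step: "\<exists>b h. b \<in> carrier G \<and> h \<in> H n i \<and> g = b \<otimes> h \<and> d \<one> b \<le> \<beta> i"
      if i: "i < M n" and g: "g \<in> H n (Suc i)" for i g
    proof -
      obtain h where h: "h \<in> H n i" "d \<one> (g \<otimes> h) < \<beta> i"
        using wit[OF n(2) i g \<eta>] unfolding \<beta>_def by blast
      have s: "subgroup (H n i) G" "subgroup (H n (Suc i)) G" using sub[OF n(2)] i by auto
      have c: "g \<in> carrier G" "h \<in> carrier G"
        using subgroup.mem_carrier[OF s(2) g] subgroup.mem_carrier[OF s(1) h(1)] by auto
      have "g = (g \<otimes> h) \<otimes> inv h" using c by (simp add: m_assoc)
      then show ?thesis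
        using h c subgroup.m_inv_closed[OF s(1) h(1)]
        by (intro exI[of _ "g \<otimes> h"] exI[of _ "inv h"]) auto
    qed
    obtain k c p where kcp: "c \<in> carrier G" "p \<in> set_pow G B k" "g = c \<otimes> p" "d \<one> c \<le> r"
      "k * (r / 2) + d \<one> c \<le> (\<Sum>j<M n. \<beta> j)"
      using chain_blocks[of r B "M n" \<beta> "H n", OF r B \<beta> H0[OF n(2)] step Bc order_refl g] by blast
    have "(\<Sum>j<M n. \<beta> j) = (\<Sum>i=1..M n. \<rho> n i) + M n * \<eta>"
      unfolding \<beta>_def by (simp add: sum.distrib sum.atLeast1_atMost_eq)
    also have "\<dots> \<le> C + 1"
    proof (rule add_mono[OF bound[OF n(2)]])
      have "M n * \<eta> \<le> M n * (1 / (M n + 1))"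
        unfolding \<eta>_def by (intro mult_left_mono) auto
      also have "\<dots> \<le> 1" by simp
      finally show "M n * \<eta> \<le> 1" .
    qed
    finally have "k * (r / 2) \<le> C + 1" using kcp(5) nonneg[of \<one> c] by linarith
    then have "k \<le> 2 * (C + 1) / r" using r by (simp add: field_simps)
    then have "Suc k \<le> Suc l" unfolding l_def by linarith
    moreover have "g \<in> set_pow G B (Suc k)"
      using kcp B[OF kcp(1,4)] by auto
    ultimately show "g \<in> set_pow G B (Suc l)"
      using set_pow_mono[OF Bc oneB] by blast
  qed
  have mono': "K n \<subseteq> K m" if "n \<ge> 1" "n \<le> m" for n m
    using that(2)
  proof (induction m rule: dec_induct)
    case (step m)
    then show ?case using mono[of m] that(1) by auto
  qed simp
  have "K n \<subseteq> set_pow G B (Suc l)" if "n \<in> {1..}" for n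
    using mono'[of n "max n n0"] large[of "max n n0"] that by (meson atLeast_iff max.cobounded1 max.cobounded2 order_trans)
  then have "(\<Union>n\<in>{1..}. K n) \<subseteq> set_pow G B (Suc l)" by (rule UN_least)
  moreover have cpt: "compactin mtopology (set_pow G B (Suc l))"
    by (rule compactin_set_pow[OF UB(2)])
  ultimately have "mtopology closure_of (\<Union>n\<in>{1..}. K n) \<subseteq> set_pow G B (Suc l)"
    using compactin_imp_closedin[OF Hausdorff_space_mtopology] by (intro closure_of_minimal)
  then have "carrier G \<subseteq> set_pow G B (Suc l)"
    unfolding dense .
  then have "set_pow G B (Suc l) = topspace mtopology"
    using set_pow_carrier[OF Bc] by (metis subset_antisym topspace_mtopology)
  then show ?thesis using cpt unfolding compact_space_def by (simp only:)
qed

text \<open>With compactness at hand, small steps in \<open>d\<close> are small in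
  \<open>dsup\<close> by \<open>dsup_uniform\<close>, so the chains of large index are fine for the
  bi-invariant metric.\<close>

lemma trivial_of_chains:
  assumes loc: "locally_compact_space mtopology"
    and dense: "mtopology closure_of (\<Union>n\<in>{1..}. K n) = carrier G"
    and mono: "\<And>n. n \<ge> 1 \<Longrightarrow> K n \<subseteq> K (Suc n)"
    and sub: "\<And>n i. n \<ge> 1 \<Longrightarrow> i \<le> M n \<Longrightarrow> subgroup (H n i) G"
    and H0: "\<And>n. n \<ge> 1 \<Longrightarrow> H n 0 = {\<one>}"
    and HM: "\<And>n. n \<ge> 1 \<Longrightarrow> H n (M n) = K n"
    and wit: "\<And>n i g \<eta>. n \<ge> 1 \<Longrightarrow> i < M n \<Longrightarrow> g \<in> H n (Suc i) \<Longrightarrow> \<eta> > 0 \<Longrightarrow>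
      \<exists>h\<in>H n i. d \<one> (g \<otimes> h) < \<rho> n (Suc i) + \<eta>"
    and bound: "\<And>n. n \<ge> 1 \<Longrightarrow> (\<Sum>i=1..M n. \<rho> n i) \<le> C"
    and small: "\<And>e. e > 0 \<Longrightarrow> \<exists>n0. \<forall>n\<ge>n0. \<forall>i\<in>{1..M n}. \<rho> n i < e"
  shows "carrier G = {\<one>}"
proof -
  have cpt: "compact_space mtopology"
    by (rule compact_space_of_chains[OF assms])
  interpret bi: bi_invariant_group G dsup by (rule bi_invariant_dsup[OF cpt])
  have mono': "K n \<subseteq> K m" if "n \<ge> 1" "n \<le> m" for n m
    using that(2)
  proof (induction m rule: dec_induct)
    case (step m)
    then show ?case using mono[of m] that(1) by auto
  qed simp
  show ?thesis
  proof (rule bi.trivial_of_fine_chains)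
    fix \<delta> e :: real and p assume \<delta>: "\<delta> > 0" and p: "p \<in> carrier G" and e: "e > 0"
    obtain \<delta>1 where \<delta>1: "\<delta>1 > 0"
      "\<And>x y. x \<in> carrier G \<Longrightarrow> y \<in> carrier G \<Longrightarrow> d x y < \<delta>1 \<Longrightarrow> dsup x y \<le> \<delta>"
      using dsup_uniform[OF cpt \<delta>] by blast
    obtain \<delta>2 where \<delta>2: "\<delta>2 > 0"
      "\<And>x y. x \<in> carrier G \<Longrightarrow> y \<in> carrier G \<Longrightarrow> d x y < \<delta>2 \<Longrightarrow> dsup x y \<le> e / 2"
      using dsup_uniform[OF cpt half_gt_zero[OF e]] by blast
    \<comment> \<open>Half of \<open>\<delta>1\<close> goes to the radius, the other half to the
      slack in the witness.\<close>
    obtain n0 where n0: "\<And>n i. n \<ge> n0 \<Longrightarrow> i \<in> {1..M n} \<Longrightarrow> \<rho> n i < \<delta>1 / 2"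
      using small[OF half_gt_zero[OF \<delta>1(1)]] by blast
    have "p \<in> mtopology closure_of (\<Union>n\<in>{1..}. K n)" using p dense by simp
    then obtain g n1 where g: "n1 \<ge> 1" "g \<in> K n1" "g \<in> carrier G" "d p g < \<delta>2"
      unfolding metric_closure_of using \<delta>2(1) by auto
    \<comment> \<open>Large enough for a fine chain and for \<open>K n\<close> to contain the
      approximating element \<open>g\<close>.\<close>
    define n where "n = max n0 n1"
    have n: "n \<ge> 1" "n \<ge> n0" "n1 \<le> n" unfolding n_def using g(1) by auto
    have "\<exists>h\<in>H n i. dsup \<one> (k \<otimes> h) \<le> \<delta>" if i: "i < M n" and k: "k \<in> H n (Suc i)" for i k
    proof -
      obtain h where h: "h \<in> H n i" "d \<one> (k \<otimes> h) < \<rho> n (Suc i) + \<delta>1 / 2"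
        using wit[OF n(1) i k, of "\<delta>1 / 2"] \<delta>1(1) by auto
      have "k \<in> carrier G" "h \<in> carrier G"
        using subgroup.mem_carrier[OF sub k] subgroup.mem_carrier[OF sub h(1)] n i by auto
      moreover have "\<rho> n (Suc i) < \<delta>1 / 2" using n0[OF n(2), of "Suc i"] i by simp
      ultimately show ?thesis using h by (intro bexI[OF _ h(1)] \<delta>1(2)) auto
    qed
    then have "bi.fine_chain \<delta> (M n) (H n)"
      unfolding bi.fine_chain_def using H0 sub n by simp
    moreover have "g \<in> H n (M n)" using HM n g mono' by blast
    moreover have "dsup g p < e"
      using \<delta>2(2)[OF p g(3,4)] bi.D_sym[OF p g(3)] e by simp
    ultimately show "\<exists>m H. bi.fine_chain \<delta> m H \<and> (\<exists>g\<in>H m. dsup g p < e)" by blast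
  qed
qed

end

theorem mainTheorem5:
  fixes G :: "('a, 'b) monoid_scheme"
    and T :: "'a topology"
    and d :: "'a \<Rightarrow> 'a \<Rightarrow> real"
    and K :: "nat \<Rightarrow> 'a set"
    and M :: "nat \<Rightarrow> nat"
    and H :: "nat \<Rightarrow> nat \<Rightarrow> 'a set"
    and \<rho> :: "nat \<Rightarrow> nat \<Rightarrow> real"
  assumes "topological_group G T"
    and "locally_compact_space T"
    and "Polish_space T"
    and "compatible_metric T d"
    and "right_invariant G d"
    and K_subgroup: "\<And>n. n \<ge> 1 \<Longrightarrow> compact_subgroup G T (K n)"
    and K_mono: "\<And>n. n \<ge> 1 \<Longrightarrow> K n \<subseteq> K (Suc n)"
    and K_dense: "T closure_of (\<Union>n\<in>{1..}. K n) = topspace T"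
    and H_subgroup: "\<And>n i. n \<ge> 1 \<Longrightarrow> i \<le> M n \<Longrightarrow> compact_subgroup G T (H n i)"
    and H_mono: "\<And>n i. n \<ge> 1 \<Longrightarrow> 1 \<le> i \<Longrightarrow> i \<le> M n \<Longrightarrow> H n (i - 1) \<subseteq> H n i"
    and H_first: "\<And>n. n \<ge> 1 \<Longrightarrow> H n 0 = {\<one>\<^bsub>G\<^esub>}"
    and H_last: "\<And>n. n \<ge> 1 \<Longrightarrow> H n (M n) = K n"
    and \<rho>_eq: "\<And>n i. n \<ge> 1 \<Longrightarrow> 1 \<le> i \<Longrightarrow> i \<le> M n \<Longrightarrow>
                  \<rho> n i = quotient_radius G d (H n i) (H n (i - 1))"
    and \<rho>_sum: "bdd_above ((\<lambda>n. \<Sum>i=1..M n. \<rho> n i) ` {1..})"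
    \<comment> \<open>The radii are nonnegative; inserting 0 only gives the maximum a value when \<open>M n = 0\<close>.\<close>
    and \<rho>_max: "(\<lambda>n. Max (insert 0 (\<rho> n ` {1..M n}))) \<longlonglongrightarrow> 0"
  shows "trivial_group G"
proof -
  have G: "group G" and carrier: "topspace T = carrier G"
    using assms(1) unfolding topological_group_def by auto
  have ms: "Metric_space (carrier G) d" and T: "Metric_space.mtopology (carrier G) d = T"
    using assms(4) unfolding compatible_metric_def carrier by auto
  interpret right_invariant_group G d
    using G ms assms(1,5) unfolding right_invariant_group_def right_invariant_group_axioms_def T by blast
  obtain C where C: "\<And>n. n \<ge> 1 \<Longrightarrow> (\<Sum>i=1..M n. \<rho> n i) \<le> C"
    using \<rho>_sum unfolding bdd_above_def by auto
  have sub: "subgroup (H n i) G" and cpt: "compactin mtopology (H n i)" if "n \<ge> 1" "i \<le> M n" for n i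
    using H_subgroup[OF that] unfolding compact_subgroup_def T by auto
  have "carrier G = {\<one>\<^bsub>G\<^esub>}"
  proof (rule trivial_of_chains[where K = K and M = M and H = H and \<rho> = \<rho> and C = C, OF _ _ K_mono sub H_first H_last _ C])
    show "locally_compact_space mtopology" using assms(2) unfolding T .
    show "mtopology closure_of (\<Union>n\<in>{1..}. K n) = carrier G" using K_dense unfolding T carrier .
    show "\<exists>h\<in>H n i. d \<one>\<^bsub>G\<^esub> (g \<otimes>\<^bsub>G\<^esub> h) < \<rho> n (Suc i) + \<eta>"
      if n: "n \<ge> 1" and i: "i < M n" and g: "g \<in> H n (Suc i)" and \<eta>: "\<eta> > 0" for n i g \<eta>
    proof -
      have "H n i \<subseteq> carrier G" "H n i \<noteq> {}" "\<rho> n (Suc i) = quotient_radius G d (H n (Suc i)) (H n i)"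
        using subgroup.subset[OF sub[of n i]] subgroup.one_closed[OF sub[of n i]] \<rho>_eq[of n "Suc i"] n i by auto
      then show ?thesis
        using quotient_radius_witness[OF cpt[of n "Suc i"] _ _ g \<eta>, of "H n i"] n i by auto
    qed
    show "\<exists>n0. \<forall>n\<ge>n0. \<forall>i\<in>{1..M n}. \<rho> n i < e" if e: "e > 0" for e
    proof -
      obtain n0 where n0: "\<And>n. n \<ge> n0 \<Longrightarrow> Max (insert 0 (\<rho> n ` {1..M n})) < e"
        using order_tendstoD(2)[OF \<rho>_max e] unfolding eventually_sequentially by blast
      have "\<rho> n i < e" if "n \<ge> n0" "i \<in> {1..M n}" for n i
        using Max_ge[of "insert 0 (\<rho> n ` {1..M n})" "\<rho> n i"] n0[OF that(1)] that(2) by simp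
      then show ?thesis by blast
    qed
  qed
  then show ?thesis using G unfolding trivial_group_def by blast
qed

end
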